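(* Let $I=(0,1)$ or $I=(0,\infty)$, and let $E$ be a quasi-Banach ideal space on $I$ such that $E^{( * )}\ne\{0\}$, the operator $D_2$ is bounded on $E^{\downarrow}$ and $(E')^{( * )}\neq\{0\}$. Then $(E')^{( * )}\subset(E^{( * )})'$ and $$\|x\|_{(E^{( * )})'}\le\|x\|_{(E')^{( * )}}\quad\text{for all }x\in(E')^{( * )}.$$ If, additionally, the operator $H^*$ is bounded on $E$, then $(E^{( * )})'\subset(E')^{( * )}$ and $$\|x\|_{(E')^{( * )}}\le\|H^*\|_{E\to E}\,\|x\|_{(E^{( * )})'}\quad\text{for all }x\in(E^{( * )})'.$$ In particular, in this case the functional $\|\cdot\|_{(E')^{( * )}}$ is a quasi-norm on $(E')^{( * )}$, and $(E')^{( * )}=(E^{( * )})'$ (equal as sets, with equivalent quasi-norms).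
   Context: $I=(0,1)$ or $(0,\infty)$ with Lebesgue measure $m$; $L^0(I)$ is the space of (classes of) real measurable functions on $I$. A quasi-normed ideal space $E$ on $I$ is a linear subspace of $L^0(I)$ with a quasi-norm such that $y\in E$, $x\in L^0$, $|x|\le|y|$ a.e. imply $x\in E$ and $\|x\|_E\le\|y\|_E$; it is a quasi-Banach ideal space if complete. Such spaces are always assumed to have a weak unit (an element positive a.e. on $I$). $x^*(t)=\inf\{\lambda>0: m\{|x|>\lambda\}\le t\}$ is the nonincreasing rearrangement. The symmetrization of $E$ is $E^{( * )}=\{x\in L^0(I):x^*\in E\}$ with functional $\|x\|_{E^{( * )}}=\|x^*\|_E$. $E^{\downarrow}$ is the cone of all $x\in E$ with $x=x^*$. Dilation operator: $D_2x(t)=x(t/2)$, $t\in I$. "$D_2$ is bounded on $E^{\downarrow}$" means that there is a constant $A<\infty$ with $\|D_2x\|_E\le A\|x\|_E$ for all $x\in E^{\downarrow}$. (Under this condition $E^{( * )}$ is a quasi-normed ideal space.) Köthe dual: $E'=\{x\in L^0(I):\|x\|_{E'}=\sup_{\|y\|_E\le1}\int_I|xy|\,dt<\infty\}$. $H^*x(t)=\int_t^l\frac{x(s)}{s}\,ds$ with $l=m(I)$; bounded on $E$ means $H^*$ maps $E$ into $E$ with $\|H^*x\|_E\le C\|x\|_E$, and $\|H^*\|_{E\to E}$ is the least such $C$. *)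

theory Defs
  imports "HOL-Analysis.Analysis"
begin

text \<open>
  Elements of \<open>L\<^sup>0(I)\<close> are represented by functions on the reals that are Lebesgue measurable
  on \<open>I\<close>; their values outside \<open>I\<close> are irrelevant. A set of classes is represented by a set of
  functions that is closed under almost everywhere equality on \<open>I\<close>.
\<close>

definition L0 :: "real set \<Rightarrow> (real \<Rightarrow> real) set" where
  "L0 I = borel_measurable (lebesgue_on I)"

definition linear_subspace_L0 :: "real set \<Rightarrow> (real \<Rightarrow> real) set \<Rightarrow> bool" where
  "linear_subspace_L0 I E \<longleftrightarrow>
     E \<subseteq> L0 I \<and>
     (\<forall>x\<in>E. \<forall>y\<in>L0 I. (AE t in lebesgue_on I. x t = y t) \<longrightarrow> y \<in> E) \<and>
     (\<lambda>t. 0) \<in> E \<and>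
     (\<forall>x\<in>E. \<forall>y\<in>E. (\<lambda>t. x t + y t) \<in> E) \<and>
     (\<forall>c. \<forall>x\<in>E. (\<lambda>t. c * x t) \<in> E)"

text \<open>The second conjunct says that \<open>N\<close> is well defined on classes.\<close>

definition quasi_norm_on :: "real set \<Rightarrow> (real \<Rightarrow> real) set \<Rightarrow> ((real \<Rightarrow> real) \<Rightarrow> real) \<Rightarrow> bool" where
  "quasi_norm_on I E N \<longleftrightarrow>
     linear_subspace_L0 I E \<and>
     (\<forall>x\<in>E. \<forall>y\<in>E. (AE t in lebesgue_on I. x t = y t) \<longrightarrow> N x = N y) \<and>
     (\<forall>x\<in>E. 0 \<le> N x) \<and>
     (\<forall>x\<in>E. N x = 0 \<longleftrightarrow> (AE t in lebesgue_on I. x t = 0)) \<and>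
     (\<forall>c. \<forall>x\<in>E. N (\<lambda>t. c * x t) = \<bar>c\<bar> * N x) \<and>
     (\<exists>C\<ge>1. \<forall>x\<in>E. \<forall>y\<in>E. N (\<lambda>t. x t + y t) \<le> C * (N x + N y))"

definition quasi_normed_ideal_space ::
    "real set \<Rightarrow> (real \<Rightarrow> real) set \<Rightarrow> ((real \<Rightarrow> real) \<Rightarrow> real) \<Rightarrow> bool" where
  "quasi_normed_ideal_space I E N \<longleftrightarrow>
     quasi_norm_on I E N \<and>
     (\<forall>y\<in>E. \<forall>x\<in>L0 I. (AE t in lebesgue_on I. \<bar>x t\<bar> \<le> \<bar>y t\<bar>) \<longrightarrow> x \<in> E \<and> N x \<le> N y) \<and>
     (\<exists>w\<in>E. AE t in lebesgue_on I. 0 < w t)"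

definition complete_on :: "(real \<Rightarrow> real) set \<Rightarrow> ((real \<Rightarrow> real) \<Rightarrow> real) \<Rightarrow> bool" where
  "complete_on E N \<longleftrightarrow>
     (\<forall>u :: nat \<Rightarrow> real \<Rightarrow> real.
        (\<forall>n. u n \<in> E) \<and>
        (\<forall>\<epsilon>>0. \<exists>K. \<forall>m\<ge>K. \<forall>n\<ge>K. N (\<lambda>t. u m t - u n t) < \<epsilon>) \<longrightarrow>
        (\<exists>x\<in>E. (\<lambda>n. N (\<lambda>t. u n t - x t)) \<longlonglongrightarrow> 0))"

definition quasi_Banach_ideal_space ::
    "real set \<Rightarrow> (real \<Rightarrow> real) set \<Rightarrow> ((real \<Rightarrow> real) \<Rightarrow> real) \<Rightarrow> bool" where
  "quasi_Banach_ideal_space I E N \<longleftrightarrow> quasi_normed_ideal_space I E N \<and> complete_on E N"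

definition nonzero_space :: "real set \<Rightarrow> (real \<Rightarrow> real) set \<Rightarrow> bool" where
  "nonzero_space I E \<longleftrightarrow> (\<exists>x\<in>E. \<not> (AE t in lebesgue_on I. x t = 0))"

text \<open>
  The rearrangement takes the value \<open>\<infinity>\<close> (the infimum of the empty set) when the distribution
  function of \<open>x\<close> stays above \<open>t\<close>, which can happen on an interval of infinite length.
\<close>

definition rearr :: "real set \<Rightarrow> (real \<Rightarrow> real) \<Rightarrow> real \<Rightarrow> ereal" where
  "rearr I x t =
     Inf {ereal r | r. 0 < r \<and> emeasure (lebesgue_on I) {s\<in>I. \<bar>x s\<bar> > r} \<le> ennreal t}"

definition rearr_real :: "real set \<Rightarrow> (real \<Rightarrow> real) \<Rightarrow> real \<Rightarrow> real" where
  "rearr_real I x t = real_of_ereal (rearr I x t)"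

text \<open>
  As \<open>E\<close> consists of real functions, membership of the rearrangement in \<open>E\<close> includes its finiteness.
\<close>

definition symm_set :: "real set \<Rightarrow> (real \<Rightarrow> real) set \<Rightarrow> (real \<Rightarrow> real) set" where
  "symm_set I E = {x \<in> L0 I. (AE t in lebesgue_on I. rearr I x t < \<infinity>) \<and> rearr_real I x \<in> E}"

definition symm_norm :: "real set \<Rightarrow> ((real \<Rightarrow> real) \<Rightarrow> real) \<Rightarrow> (real \<Rightarrow> real) \<Rightarrow> real" where
  "symm_norm I N x = N (rearr_real I x)"

definition decr_cone :: "real set \<Rightarrow> (real \<Rightarrow> real) set \<Rightarrow> (real \<Rightarrow> real) set" where
  "decr_cone I E = {x \<in> E. AE t in lebesgue_on I. ereal (x t) = rearr I x t}"

definition dilation2 :: "(real \<Rightarrow> real) \<Rightarrow> real \<Rightarrow> real" where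
  "dilation2 x t = x (t / 2)"

definition dilation2_bounded_on_cone ::
    "real set \<Rightarrow> (real \<Rightarrow> real) set \<Rightarrow> ((real \<Rightarrow> real) \<Rightarrow> real) \<Rightarrow> bool" where
  "dilation2_bounded_on_cone I E N \<longleftrightarrow>
     (\<exists>A. \<forall>x\<in>decr_cone I E. dilation2 x \<in> E \<and> N (dilation2 x) \<le> A * N x)"

definition kothe_ennorm ::
    "real set \<Rightarrow> (real \<Rightarrow> real) set \<Rightarrow> ((real \<Rightarrow> real) \<Rightarrow> real) \<Rightarrow> (real \<Rightarrow> real) \<Rightarrow> ennreal" where
  "kothe_ennorm I E N x =
     (SUP y\<in>{y\<in>E. N y \<le> 1}. \<integral>\<^sup>+ t. ennreal \<bar>x t * y t\<bar> \<partial>lebesgue_on I)"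

definition kothe_set ::
    "real set \<Rightarrow> (real \<Rightarrow> real) set \<Rightarrow> ((real \<Rightarrow> real) \<Rightarrow> real) \<Rightarrow> (real \<Rightarrow> real) set" where
  "kothe_set I E N = {x \<in> L0 I. kothe_ennorm I E N x < \<infinity>}"

definition kothe_norm ::
    "real set \<Rightarrow> (real \<Rightarrow> real) set \<Rightarrow> ((real \<Rightarrow> real) \<Rightarrow> real) \<Rightarrow> (real \<Rightarrow> real) \<Rightarrow> real" where
  "kothe_norm I E N x = enn2real (kothe_ennorm I E N x)"

definition Hstar :: "real set \<Rightarrow> (real \<Rightarrow> real) \<Rightarrow> real \<Rightarrow> real" where
  "Hstar I x t = (LINT s:{t<..} \<inter> I|lebesgue. x s / s)"

text \<open>
  Integrability is required explicitly, because the integral of a non-integrable function is 0 here.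
\<close>

definition Hstar_bound ::
    "real set \<Rightarrow> (real \<Rightarrow> real) set \<Rightarrow> ((real \<Rightarrow> real) \<Rightarrow> real) \<Rightarrow> real \<Rightarrow> bool" where
  "Hstar_bound I E N C \<longleftrightarrow>
     0 \<le> C \<and>
     (\<forall>x\<in>E. (\<forall>t\<in>I. set_integrable lebesgue ({t<..} \<inter> I) (\<lambda>s. x s / s)) \<and>
            Hstar I x \<in> E \<and> N (Hstar I x) \<le> C * N x)"

definition Hstar_bounded ::
    "real set \<Rightarrow> (real \<Rightarrow> real) set \<Rightarrow> ((real \<Rightarrow> real) \<Rightarrow> real) \<Rightarrow> bool" where
  "Hstar_bounded I E N \<longleftrightarrow> (\<exists>C. Hstar_bound I E N C)"

definition Hstar_opnorm ::
    "real set \<Rightarrow> (real \<Rightarrow> real) set \<Rightarrow> ((real \<Rightarrow> real) \<Rightarrow> real) \<Rightarrow> real" where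
  "Hstar_opnorm I E N = Inf {C. Hstar_bound I E N C}"

definition equivalent_on ::
    "(real \<Rightarrow> real) set \<Rightarrow> ((real \<Rightarrow> real) \<Rightarrow> real) \<Rightarrow> ((real \<Rightarrow> real) \<Rightarrow> real) \<Rightarrow> bool" where
  "equivalent_on E N1 N2 \<longleftrightarrow>
     (\<exists>c>0. \<exists>C>0. \<forall>x\<in>E. c * N1 x \<le> N2 x \<and> N2 x \<le> C * N1 x)"

end

theory Submission
  imports Defs "HOL-Probability.Distribution_Functions"
begin

text \<open>
  The first embedding is the Hardy-Littlewood inequality \<open>\<integral>|x y| \<le> \<integral>x\<^sup>* y\<^sup>*\<close>. For the second one, let
  \<open>y \<ge> 0\<close> be in the unit ball of \<open>E\<close>. As \<open>x\<^sup>*\<close> is decreasing, Fubini gives \<open>\<integral>x\<^sup>* y \<le> \<integral>x\<^sup>* H\<^sup>*y\<close>, and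
  \<open>z = H\<^sup>*y\<close> is decreasing with norm at most \<open>C = \<parallel>H\<^sup>*\<parallel>\<close> in \<open>E\<close>. Since Lebesgue measure has no atoms, \<open>\<integral>x\<^sup>* z\<close> is
  the supremum of \<open>\<integral>|x| w\<close> over all \<open>w \<ge> 0\<close> with \<open>w\<^sup>* \<le> z\<close>, and each such \<open>w\<close> has norm at most \<open>C\<close> in
  \<open>E\<^sup>(\<^sup>*\<^sup>)\<close>. The functional \<open>\<parallel>x\<^sup>*\<parallel>\<close> inherits its quasi-triangle inequality from the Koethe norm, to which
  it is equivalent.
\<close>

section \<open>Layer cake formula and probability integral transform\<close>

text \<open>The supremum over w need not be attained: for x(t) = t/(1+t) on the half line the
  rearrangement is constantly 1, while |x| < 1 everywhere, so no w reaches the integral of z when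
  that is finite and positive. A rearranging map is therefore built only for simple functions with
  bounded support that increase to |x|, and the general case is a limit. On the half line a
  rearrangement may be infinite, so an element of the dual of the symmetrization must first be shown
  to have a finite one. The same information is needed for definiteness of the dual norm. Both come
  from a nonzero element of the symmetrization of E: it puts a multiple of the indicator of some
  (0,a) into E, and testing against that function bounds the rearrangement pointwise. The norm of H*
  is an infimum of bounds, and a bound may be 0 as far as its definition goes. The estimates divide
  by the bound, so they are proved for positive bounds and then passed to the infimum.\<close>

lemma sigma_finite_lebesgue_on:
  fixes S :: "'a::euclidean_space set"
  assumes "S \<in> sets lebesgue"
  shows "sigma_finite_measure (lebesgue_on S)"
proof (rule sigma_finite_measure_restrict_space[OF _ assms])
  obtain A :: "'a set set" where "countable A" "A \<subseteq> sets lborel" "\<Union>A = UNIV"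
      "\<forall>a\<in>A. emeasure lborel a \<noteq> \<infinity>"
    using lborel.sigma_finite_countable by auto
  then show "sigma_finite_measure (lebesgue :: 'a measure)"
    by (intro sigma_finite_measure.intro exI[of _ A]) auto
qed

lemma emeasure_ennreal_less: "emeasure lborel {r. 0 \<le> r \<and> ennreal r < c} = c"
proof (cases c)
  case (real a)
  then have "{r. 0 \<le> r \<and> ennreal r < c} = {0..<a}"
    by (auto simp: ennreal_less_iff)
  then show ?thesis using real by simp
next
  case top
  have "emeasure lborel {0::real..} = \<infinity>"
  proof (rule ccontr)
    assume "emeasure lborel {0::real..} \<noteq> \<infinity>"
    then obtain b where b: "0 \<le> b" "emeasure lborel {0::real..} = ennreal b"
      by (cases "emeasure lborel {0::real..}") auto
    have "emeasure lborel {0..b+1} \<le> emeasure lborel {0::real..}"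
      by (intro emeasure_mono) auto
    then show False using b by (auto simp: ennreal_le_iff2)
  qed
  moreover have "{r. 0 \<le> r \<and> ennreal r < c} = {0..}" using top by auto
  ultimately show ?thesis using top by simp
qed

text \<open>Each value f x is the length of the set of levels r \<ge> 0 below it, also when it is
  infinite; Fubini then exchanges points and levels.\<close>

lemma (in sigma_finite_measure) layer_cake:
  fixes f g :: "'a \<Rightarrow> ennreal"
  assumes [measurable]: "f \<in> borel_measurable M" "g \<in> borel_measurable M"
  shows "(\<integral>\<^sup>+x. f x * g x \<partial>M) =
    (\<integral>\<^sup>+r. (\<integral>\<^sup>+x. g x * indicator {x. ennreal r < f x} x \<partial>M) * indicator {0..} r \<partial>lborel)"
proof -
  interpret pair_sigma_finite M lborel ..
  let ?h = "\<lambda>x r. g x * (indicator {x. ennreal r < f x} x * indicator {0..} r)"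
  have m: "case_prod ?h \<in> borel_measurable (M \<Otimes>\<^sub>M lborel)"
    by measurable
  have "(\<integral>\<^sup>+x. f x * g x \<partial>M) = (\<integral>\<^sup>+x. g x * emeasure lborel {r. 0 \<le> r \<and> ennreal r < f x} \<partial>M)"
    by (simp add: emeasure_ennreal_less mult.commute)
  also have "\<dots> = (\<integral>\<^sup>+x. (\<integral>\<^sup>+r. ?h x r \<partial>lborel) \<partial>M)"
  proof (intro nn_integral_cong)
    fix x
    have "(\<integral>\<^sup>+r. ?h x r \<partial>lborel) = (\<integral>\<^sup>+r. g x * indicator {r. 0 \<le> r \<and> ennreal r < f x} r \<partial>lborel)"
      by (intro nn_integral_cong) (auto split: split_indicator)
    also have "\<dots> = g x * emeasure lborel {r. 0 \<le> r \<and> ennreal r < f x}"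
      by (subst nn_integral_cmult_indicator) auto
    finally show "g x * emeasure lborel {r. 0 \<le> r \<and> ennreal r < f x} = (\<integral>\<^sup>+r. ?h x r \<partial>lborel)" ..
  qed
  also have "\<dots> = (\<integral>\<^sup>+r. (\<integral>\<^sup>+x. ?h x r \<partial>M) \<partial>lborel)"
    using Fubini'[OF m] ..
  also have "\<dots> = (\<integral>\<^sup>+r. (\<integral>\<^sup>+x. g x * indicator {x. ennreal r < f x} x \<partial>M) * indicator {0..} r \<partial>lborel)"
    by (intro nn_integral_cong) (auto simp: nn_integral_multc split: split_indicator)
  finally show ?thesis .
qed

text \<open>Slicing both factors reduces inequalities between integrals of products to inequalities
  between measures of intersections of superlevel sets.\<close>

lemma (in sigma_finite_measure) layer_cake2:
  fixes f g :: "'a \<Rightarrow> ennreal"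
  assumes [measurable]: "f \<in> borel_measurable M" "g \<in> borel_measurable M"
  shows "(\<integral>\<^sup>+x. f x * g x \<partial>M) =
    (\<integral>\<^sup>+r. (\<integral>\<^sup>+s. emeasure M {x\<in>space M. ennreal r < f x \<and> ennreal s < g x} * indicator {0..} s \<partial>lborel)
       * indicator {0..} r \<partial>lborel)"
proof -
  have "(\<integral>\<^sup>+x. g x * indicator {x. ennreal r < f x} x \<partial>M) =
     (\<integral>\<^sup>+s. emeasure M {x\<in>space M. ennreal r < f x \<and> ennreal s < g x} * indicator {0..} s \<partial>lborel)" for r
  proof (subst layer_cake, measurable, intro nn_integral_cong, rule arg_cong2[where f="(*)"])
    fix s
    have "(\<integral>\<^sup>+x. indicator {x. ennreal r < f x} x * indicator {x. ennreal s < g x} x \<partial>M) =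
      (\<integral>\<^sup>+x. indicator {x\<in>space M. ennreal r < f x \<and> ennreal s < g x} x \<partial>M)"
      by (intro nn_integral_cong) (auto split: split_indicator)
    also have "\<dots> = emeasure M {x\<in>space M. ennreal r < f x \<and> ennreal s < g x}"
      by (subst nn_integral_indicator) measurable
    finally show "(\<integral>\<^sup>+x. indicator {x. ennreal r < f x} x * indicator {x. ennreal s < g x} x \<partial>M) =
      emeasure M {x\<in>space M. ennreal r < f x \<and> ennreal s < g x}" .
  qed simp
  then show ?thesis by (subst layer_cake) simp_all
qed

text \<open>Superlevel sets of a decreasing function on an interval are intervals. The codomain is
  generic because the lemma serves real, \<open>ereal\<close> and \<open>ennreal\<close>
  functions.\<close>

lemma borel_measurable_antimono_on:
  fixes f :: "real \<Rightarrow> 'b::{second_countable_topology, linorder_topology}"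
  assumes S: "is_interval S" and f: "antimono_on S f"
  shows "f \<in> borel_measurable (restrict_space borel S)"
proof (rule borel_measurableI_greater)
  fix y
  have "is_interval {x\<in>S. y < f x}"
    unfolding is_interval_1
  proof safe
    fix a b x assume *: "a \<in> S" "b \<in> S" "y < f b" "a \<le> x" "x \<le> b"
    show "x \<in> S" using S * unfolding is_interval_1 by blast
    then have "f b \<le> f x" using f * by (auto dest: monotone_onD)
    then show "y < f x" using * by simp
  qed
  then have "{x\<in>S. y < f x} \<in> sets borel" by (rule real_interval_borel_measurable)
  moreover have "{x \<in> space (restrict_space borel S). y < f x} = {x\<in>S. y < f x}"
    by (auto simp: space_restrict_space)
  moreover have "S \<in> sets borel" by (rule real_interval_borel_measurable[OF S])
  ultimately show "{x \<in> space (restrict_space borel S). y < f x} \<in> sets (restrict_space borel S)"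
    by (auto simp: sets_restrict_space_iff)
qed

text \<open>Without atoms \<open>cdf M\<close> is continuous, so each level b strictly between 0 and
  the total mass is a value \<open>cdf M y\<close>. Then \<open>{..y}\<close> has measure b and
  separates the sublevel sets of \<open>cdf M\<close> at b, which fixes their measure.\<close>

lemma (in finite_borel_measure) distr_cdf:
  assumes atomless: "\<And>x. measure M {x} = 0"
  shows "distr M borel (cdf M) = density lborel (indicator {0<..<measure M (space M)})"
proof -
  let ?m = "measure M (space M)"
  have cont: "continuous_on UNIV (cdf M)"
    by (auto simp: continuous_on_eq_continuous_within isCont_cdf atomless)
  have [measurable]: "cdf M \<in> borel_measurable M"
    using borel_measurable_continuous_onI[OF cont] M_is_borel by (simp cong: measurable_cong_sets)
  have sp: "space M = UNIV" by (rule borel_UNIV)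
  have ivt: "\<exists>y. cdf M y = b" if b: "0 < b" "b < ?m" for b
  proof -
    have "\<forall>\<^sub>F x in at_bot. cdf M x < b" using cdf_lim_at_bot b by (auto dest: order_tendstoD)
    then obtain y1 where y1: "cdf M y1 < b" by (auto simp: eventually_at_bot_linorder)
    have "\<forall>\<^sub>F x in at_top. cdf M x > b" using cdf_lim_at_top b by (auto dest: order_tendstoD)
    then obtain y2 where y2: "cdf M y2 > b" by (auto simp: eventually_at_top_linorder)
    have "y1 \<le> y2" using y1 y2 cdf_nondecreasing[of y2 y1] by linarith
    then show ?thesis
      using IVT'[of "cdf M" y1 b y2] y1 y2 continuous_on_subset[OF cont] by auto
  qed
  have lt: "measure M {y. cdf M y < b} \<le> b" if b: "0 < b" "b < ?m" for b
  proof -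
    obtain y where y: "cdf M y = b" using ivt[OF b] ..
    have "measure M {y. cdf M y < b} \<le> measure M {..y}"
    proof (rule finite_measure_mono)
      show "{y. cdf M y < b} \<subseteq> {..y}"
      proof safe
        fix x assume "cdf M x < b"
        then show "x \<le> y" using y cdf_nondecreasing[of y x] by linarith
      qed
    qed (auto simp: M_is_borel)
    then show ?thesis using y by (simp add: cdf_def)
  qed
  have ge: "b \<le> measure M {y. cdf M y \<le> b}" if b: "0 < b" "b < ?m" for b
  proof -
    obtain y where y: "cdf M y = b" using ivt[OF b] ..
    have "{y. cdf M y \<le> b} \<in> sets M"
      using measurable_sets[of "cdf M" M borel "{..b}"] by (simp add: sp vimage_def)
    then have "measure M {..y} \<le> measure M {y. cdf M y \<le> b}"
      using y cdf_nondecreasing by (intro finite_measure_mono) (auto intro: order_trans)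
    then show ?thesis using y by (simp add: cdf_def)
  qed
  have S: "{y. cdf M y < b} \<in> sets M" "{y. cdf M y \<le> b} \<in> sets M" for b
    using measurable_sets[of "cdf M" M borel "{..b}"] measurable_sets[of "cdf M" M borel "{..<b}"]
    by (simp_all add: sp vimage_def)
  have le: "measure M {y. cdf M y \<le> b} = b" if b: "0 \<le> b" "b < ?m" for b
  proof (rule antisym)
    \<comment> \<open>\<open>lt\<close> controls strict sublevel sets at positive levels only.
      Approaching b by levels c > b gives the nonstrict version and includes b = 0.\<close>
    show "measure M {y. cdf M y \<le> b} \<le> b"
    proof (rule dense_ge_bounded[OF b(2)])
      fix c assume c: "b < c" "c < ?m"
      have "measure M {y. cdf M y \<le> b} \<le> measure M {y. cdf M y < c}"
        using c S by (intro finite_measure_mono) auto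
      also have "\<dots> \<le> c" using c b by (intro lt) auto
      finally show "measure M {y. cdf M y \<le> b} \<le> c" .
    qed
    show "b \<le> measure M {y. cdf M y \<le> b}"
      using ge[of b] b by (cases "b = 0") auto
  qed
  show ?thesis
  proof (rule measure_eqI_lessThan)
    fix x :: real
    have L: "emeasure (distr M borel (cdf M)) {x<..} = measure M {y. x < cdf M y}"
      by (subst emeasure_distr) (auto simp: sp vimage_def emeasure_eq_measure)
    then show "emeasure (distr M borel (cdf M)) {x<..} < \<infinity>" by simp
    have R: "emeasure (density lborel (indicator {0<..<?m})) {x<..} = emeasure lborel ({0<..<?m} \<inter> {x<..})"
      by (simp add: emeasure_density nn_integral_indicator flip: indicator_inter_arith)
    consider "x < 0" | "0 \<le> x" "x < ?m" | "?m \<le> x" by linarith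
    then have "emeasure lborel ({0<..<?m} \<inter> {x<..}) = measure M {y. x < cdf M y}"
    proof cases
      case 1
      then have "{y. x < cdf M y} = space M" "{0<..<?m} \<inter> {x<..} = {0<..<?m}"
        using cdf_nonneg by (auto simp: sp intro: less_le_trans)
      then show ?thesis by simp
    next
      case 2
      have "{y. x < cdf M y} = space M - {y. cdf M y \<le> x}" by (auto simp: sp)
      moreover have "{0<..<?m} \<inter> {x<..} = {x<..<?m}" using 2 by auto
      ultimately show ?thesis using finite_measure_compl[OF S(2), of x] le[OF 2] 2 by simp
    next
      case 3
      then have "{y. x < cdf M y} = {}" "{0<..<?m} \<inter> {x<..} = {}"
        using cdf_bounded by (auto simp: not_less intro: order_trans)
      then show ?thesis by (simp only: measure_empty) simp
    qed
    then show "emeasure (distr M borel (cdf M)) {x<..} =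
        emeasure (density lborel (indicator {0<..<?m})) {x<..}"
      using L R by simp
  qed auto
qed

section \<open>Rearrangements\<close>

lemma borel_measurable_lebesgue_on_antimono_on:
  fixes f :: "real \<Rightarrow> 'b::{second_countable_topology, linorder_topology}"
  assumes "is_interval S" "antimono_on S f"
  shows "f \<in> borel_measurable (lebesgue_on S)"
proof -
  have "(\<lambda>t. t) \<in> lebesgue_on S \<rightarrow>\<^sub>M restrict_space borel S"
    by (intro measurable_restrict_space3 measurable_completion) auto
  from measurable_compose[OF this borel_measurable_antimono_on[OF assms]] show ?thesis .
qed

lemma emeasure_ennreal_less_pos: "emeasure lborel {r. 0 < r \<and> ennreal r < c} = c"
proof -
  have "{r. 0 < r \<and> ennreal r < c} = {r. 0 \<le> r \<and> ennreal r < c} - {0}"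
    by auto
  moreover have "{0::real} \<in> null_sets lborel" by (rule finite_imp_null_set_lborel) simp
  moreover have "{r. 0 \<le> r \<and> ennreal r < c} \<in> sets lborel"
    by measurable
  ultimately show ?thesis
    by (simp add: emeasure_Diff_null_set emeasure_ennreal_less)
qed

lemma ereal_eqI_less:
  fixes a b :: ereal
  assumes "0 \<le> a" "0 \<le> b" and iff: "\<And>r. 0 \<le> r \<Longrightarrow> ereal r < a \<longleftrightarrow> ereal r < b"
  shows "a = b"
proof -
  have le: "a \<le> b" if "0 \<le> b" "\<And>r. 0 \<le> r \<Longrightarrow> ereal r < a \<Longrightarrow> ereal r < b" for a b :: ereal
  proof (rule ccontr)
    assume "\<not> a \<le> b"
    then obtain r where r: "b < ereal r" "ereal r < a" using ereal_dense2[of b a] by (auto simp: not_le)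
    then have "0 \<le> r" using that(1) by (metis ereal_less_eq(5) less_imp_le order_trans)
    then show False using that(2) r by (auto dest: less_asym)
  qed
  show ?thesis using le[of b a] le[of a b] assms by auto
qed

lemma ennreal_less_e2ennreal_iff:
  assumes "0 \<le> r"
  shows "ennreal r < e2ennreal a \<longleftrightarrow> ereal r < a"
  using assms by (cases a) (auto simp: ennreal_less_iff e2ennreal_neg ennreal_neg)

locale initial_interval =
  fixes I :: "real set"
  assumes I_cases: "I = {0<..<1} \<or> I = {0<..}"
begin

lemma sets_I [measurable, simp]: "I \<in> sets borel" "I \<in> sets lebesgue"
  using I_cases by auto

lemma is_interval_I: "is_interval I"
  using I_cases by (auto simp: is_interval_1)

sublocale sigma_finite_measure "lebesgue_on I"
  by (rule sigma_finite_lebesgue_on) simp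

text \<open>Both intervals are initial segments of the positive half line whose length is the
  measure of I. This form lets most later arguments treat them together.\<close>

lemma mem_I_iff: "t \<in> I \<longleftrightarrow> 0 < t \<and> ennreal t < emeasure lebesgue I"
proof -
  have "{r. 0 < r \<and> ennreal r < top} = {0<..}" by auto
  then have "emeasure lborel {0::real<..} = top"
    using emeasure_ennreal_less_pos[of top] by simp
  then show ?thesis using I_cases by (auto simp: ennreal_less_iff)
qed

lemma I_down: "t \<in> I \<Longrightarrow> 0 < s \<Longrightarrow> s \<le> t \<Longrightarrow> s \<in> I"
  using I_cases by auto

lemma emeasure_on_I: "A \<subseteq> I \<Longrightarrow> emeasure (lebesgue_on I) A = emeasure lebesgue A"
  by (simp add: emeasure_restrict_space)

lemma emeasure_initial:
  assumes "c \<le> emeasure lebesgue I"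
  shows "emeasure (lebesgue_on I) {t\<in>I. ennreal t < c} = c"
proof -
  have "{t\<in>I. ennreal t < c} = {t. 0 < t \<and> ennreal t < c}"
    using assms by (auto simp: mem_I_iff)
  moreover have "{t. 0 < t \<and> ennreal t < c} \<in> sets lborel" by measurable
  moreover have "{t\<in>I. ennreal t < c} \<subseteq> I" by auto
  ultimately show ?thesis
    using emeasure_on_I[of "{t\<in>I. ennreal t < c}"] emeasure_ennreal_less_pos[of c] by simp
qed

definition distr_fun :: "(real \<Rightarrow> real) \<Rightarrow> real \<Rightarrow> ennreal" where
  "distr_fun x r = emeasure (lebesgue_on I) {s\<in>I. r < \<bar>x s\<bar>}"

lemma L0_measurable [measurable_dest]: "x \<in> L0 I \<Longrightarrow> x \<in> borel_measurable (lebesgue_on I)"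
  by (simp add: L0_def)

lemma sets_level:
  assumes [measurable]: "x \<in> L0 I"
  shows "{s\<in>I. r < \<bar>x s\<bar>} \<in> sets (lebesgue_on I)"
proof -
  have "{s\<in>space (lebesgue_on I). r < \<bar>x s\<bar>} \<in> sets (lebesgue_on I)" by measurable
  then show ?thesis by simp
qed

lemma distr_fun_le: "distr_fun x r \<le> emeasure lebesgue I"
  unfolding distr_fun_def by (subst emeasure_on_I) (auto intro!: emeasure_mono simp del: emeasure_completion)

lemma distr_fun_antimono: "x \<in> L0 I \<Longrightarrow> r \<le> r' \<Longrightarrow> distr_fun x r' \<le> distr_fun x r"
  unfolding distr_fun_def by (intro emeasure_mono sets_level) auto

lemma distr_fun_mono_AE:
  assumes "x \<in> L0 I" "y \<in> L0 I" "AE s in lebesgue_on I. \<bar>x s\<bar> \<le> \<bar>y s\<bar>"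
  shows "distr_fun x r \<le> distr_fun y r"
  unfolding distr_fun_def using assms(3)
  by (intro emeasure_mono_AE sets_level assms) auto

text \<open>The levels are cut by strict inequalities, so the superlevel sets at r + 1/(n+1)
  increase to the one at r.\<close>

lemma distr_fun_right_cont:
  assumes x: "x \<in> L0 I"
  shows "distr_fun x r = (SUP n. distr_fun x (r + 1 / real (Suc n)))"
proof -
  have "(SUP n. distr_fun x (r + 1 / real (Suc n))) =
      emeasure (lebesgue_on I) (\<Union>n. {s\<in>I. r + 1 / real (Suc n) < \<bar>x s\<bar>})"
    unfolding distr_fun_def
  proof (rule SUP_emeasure_incseq)
    show "incseq (\<lambda>n. {s \<in> I. r + 1 / real (Suc n) < \<bar>x s\<bar>})"
    proof (intro incseq_SucI subsetI, safe)
      fix n s assume *: "r + 1 / real (Suc n) < \<bar>x s\<bar>"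
      have "1 / real (Suc (Suc n)) \<le> 1 / real (Suc n)" by (simp add: frac_le)
      then show "r + 1 / real (Suc (Suc n)) < \<bar>x s\<bar>" using * by linarith
    qed
  qed (use sets_level[OF x] in auto)
  also have "(\<Union>n. {s\<in>I. r + 1 / real (Suc n) < \<bar>x s\<bar>}) = {s\<in>I. r < \<bar>x s\<bar>}"
  proof safe
    fix n s assume *: "r + 1 / real (Suc n) < \<bar>x s\<bar>"
    have "0 < 1 / real (Suc n)" by simp
    then show "r < \<bar>x s\<bar>" using * by linarith
  next
    fix s assume s: "s \<in> I" "r < \<bar>x s\<bar>"
    then obtain n where "1 / real (Suc n) < \<bar>x s\<bar> - r"
      using nat_approx_posE[of "\<bar>x s\<bar> - r"] by auto
    then show "s \<in> (\<Union>n. {s\<in>I. r + 1 / real (Suc n) < \<bar>x s\<bar>})" using s by (auto intro!: exI[of _ n])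
  qed
  finally show ?thesis by (simp add: distr_fun_def)
qed

lemma rearr_def': "rearr I x t = Inf {ereal r | r. 0 < r \<and> distr_fun x r \<le> ennreal t}"
  by (simp add: rearr_def distr_fun_def)

lemma rearr_nonneg: "0 \<le> rearr I x t"
  unfolding rearr_def' by (rule Inf_greatest) auto

lemma rearr_antimono: "s \<le> t \<Longrightarrow> rearr I x t \<le> rearr I x s"
  unfolding rearr_def' by (rule Inf_superset_mono) (auto intro: order_trans[OF _ ennreal_leI])

text \<open>The distribution function and the rearrangement are generalized inverses of each other.
  From right to left, right continuity supplies a level strictly above r at which the inequality
  still holds; without it only r \<le> \<open>rearr I x t\<close> would follow.\<close>

lemma less_rearr_iff:
  assumes x: "x \<in> L0 I" and r: "0 \<le> r"
  shows "ereal r < rearr I x t \<longleftrightarrow> ennreal t < distr_fun x r"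
proof
  assume "ereal r < rearr I x t"
  then obtain r' where r': "r < r'" "ereal r' < rearr I x t"
    using ereal_dense2 by (metis ereal_less_eq(3) less_le_not_le)
  have "\<not> distr_fun x r' \<le> ennreal t"
  proof
    assume "distr_fun x r' \<le> ennreal t"
    then have "rearr I x t \<le> ereal r'"
      unfolding rearr_def' using r r' by (intro Inf_lower) auto
    then show False using r' by simp
  qed
  then show "ennreal t < distr_fun x r"
    using distr_fun_antimono[OF x, of r r'] r' by (auto simp: not_le intro: less_le_trans)
next
  assume "ennreal t < distr_fun x r"
  then obtain n where n: "ennreal t < distr_fun x (r + 1 / real (Suc n))"
    by (subst (asm) distr_fun_right_cont[OF x]) (auto simp: less_SUP_iff)
  have "ereal (r + 1 / real (Suc n)) \<le> rearr I x t"
    unfolding rearr_def'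
  proof (rule Inf_greatest, safe)
    fix r' assume "distr_fun x r' \<le> ennreal t"
    then have "\<not> r' \<le> r + 1 / real (Suc n)"
      using distr_fun_antimono[OF x] n by (meson leD order_trans)
    then show "ereal (r + 1 / real (Suc n)) \<le> ereal r'" by simp
  qed
  moreover have "ereal r < ereal (r + 1 / real (Suc n))" by simp
  ultimately show "ereal r < rearr I x t" by (rule less_le_trans[rotated])
qed

lemma rearr_mono_distr_fun:
  assumes "\<And>r. 0 < r \<Longrightarrow> distr_fun x r \<le> distr_fun y r"
  shows "rearr I x t \<le> rearr I y t"
  unfolding rearr_def' by (rule Inf_superset_mono) (auto intro: order_trans[OF assms])

lemma rearr_mono_AE:
  assumes "x \<in> L0 I" "y \<in> L0 I" "AE s in lebesgue_on I. \<bar>x s\<bar> \<le> \<bar>y s\<bar>"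
  shows "rearr I x t \<le> rearr I y t"
  using distr_fun_mono_AE[OF assms] by (rule rearr_mono_distr_fun)

lemma rearr_cong_AE:
  assumes "x \<in> L0 I" "y \<in> L0 I" "AE s in lebesgue_on I. \<bar>x s\<bar> = \<bar>y s\<bar>"
  shows "rearr I x = rearr I y"
proof
  have "AE s in lebesgue_on I. \<bar>x s\<bar> \<le> \<bar>y s\<bar>" "AE s in lebesgue_on I. \<bar>y s\<bar> \<le> \<bar>x s\<bar>"
    using assms(3) by auto
  then show "rearr I x t = rearr I y t" for t
    by (intro antisym rearr_mono_AE assms)
qed

lemma rearr_scale:
  assumes x: "x \<in> L0 I" and c: "c \<noteq> 0"
  shows "rearr I (\<lambda>s. c * x s) t = ereal \<bar>c\<bar> * rearr I x t"
proof (rule ereal_eqI_less)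
  have cx: "(\<lambda>s. c * x s) \<in> L0 I" using x by (simp add: L0_def)
  fix r :: real assume r: "0 \<le> r"
  have "distr_fun (\<lambda>s. c * x s) r = distr_fun x (r / \<bar>c\<bar>)"
    using c by (simp add: distr_fun_def abs_mult pos_divide_less_eq mult.commute)
  moreover have "0 \<le> r / \<bar>c\<bar>" using r by simp
  ultimately have "ereal r < rearr I (\<lambda>s. c * x s) t \<longleftrightarrow> ereal (r / \<bar>c\<bar>) < rearr I x t"
    using less_rearr_iff[OF cx r] less_rearr_iff[OF x, of "r / \<bar>c\<bar>"] by simp
  also have "\<dots> \<longleftrightarrow> ereal r < ereal \<bar>c\<bar> * rearr I x t"
    using c rearr_nonneg[of x t]
    by (cases "rearr I x t") (auto simp: pos_divide_less_eq mult.commute)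
  finally show "ereal r < rearr I (\<lambda>s. c * x s) t \<longleftrightarrow> ereal r < ereal \<bar>c\<bar> * rearr I x t" .
qed (auto simp: rearr_nonneg)

lemma rearr_borel_measurable [measurable]: "rearr I x \<in> borel_measurable (lebesgue_on I)"
  by (intro borel_measurable_lebesgue_on_antimono_on is_interval_I monotone_onI rearr_antimono)

lemma rearr_real_L0: "rearr_real I x \<in> L0 I"
  unfolding rearr_real_def[abs_def] L0_def by measurable

lemma rearr_real_nonneg: "0 \<le> rearr_real I x t"
  by (simp add: rearr_real_def rearr_nonneg real_of_ereal_pos)

text \<open>\<open>rearr_real\<close> has the default value 0 where the rearrangement is infinite,
  which would falsify integral estimates. Here the value stays infinite.\<close>

definition erearr :: "(real \<Rightarrow> real) \<Rightarrow> real \<Rightarrow> ennreal" where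
  "erearr x t = e2ennreal (rearr I x t)"

lemma erearr_antimono: "s \<le> t \<Longrightarrow> erearr x t \<le> erearr x s"
  unfolding erearr_def by (intro e2ennreal_mono rearr_antimono)

lemma erearr_borel_measurable [measurable]: "erearr x \<in> borel_measurable (lebesgue_on I)"
  by (intro borel_measurable_lebesgue_on_antimono_on is_interval_I monotone_onI erearr_antimono)

lemma less_erearr_iff:
  "x \<in> L0 I \<Longrightarrow> 0 \<le> r \<Longrightarrow> ennreal r < erearr x t \<longleftrightarrow> ennreal t < distr_fun x r"
  by (simp add: erearr_def ennreal_less_e2ennreal_iff less_rearr_iff)

lemma erearr_eq_rearr_real: "rearr I x t < \<infinity> \<Longrightarrow> erearr x t = ennreal (rearr_real I x t)"
  using rearr_nonneg[of x t] by (cases "rearr I x t") (auto simp: erearr_def rearr_real_def)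

lemma erearr_finite_iff: "erearr x t < \<infinity> \<longleftrightarrow> rearr I x t < \<infinity>"
  by (cases "rearr I x t") (auto simp: erearr_def e2ennreal_neg)

text \<open>By \<open>layer_cake2\<close> it suffices to compare superlevel sets. An intersection
  has at most the smaller of the two measures, and for the rearrangements, whose superlevel sets are
  nested initial segments, the intersection attains this minimum.\<close>

theorem hardy_littlewood:
  assumes x: "x \<in> L0 I" and y: "y \<in> L0 I"
  shows "(\<integral>\<^sup>+t. ennreal \<bar>x t * y t\<bar> \<partial>lebesgue_on I) \<le> (\<integral>\<^sup>+t. erearr x t * erearr y t \<partial>lebesgue_on I)"
proof -
  note [measurable] = x y
  have le: "emeasure (lebesgue_on I) {t\<in>I. ennreal r < ennreal \<bar>x t\<bar> \<and> ennreal s < ennreal \<bar>y t\<bar>}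
      \<le> emeasure (lebesgue_on I) {t\<in>I. ennreal r < erearr x t \<and> ennreal s < erearr y t}"
    if rs: "0 \<le> r" "0 \<le> s" for r s
  proof -
    let ?A = "{t\<in>I. r < \<bar>x t\<bar> \<and> s < \<bar>y t\<bar>}"
    have "emeasure (lebesgue_on I) ?A \<le> min (distr_fun x r) (distr_fun y s)"
      unfolding distr_fun_def
      by (intro min.boundedI emeasure_mono sets_level x y) auto
    also have "\<dots> = emeasure (lebesgue_on I) {t\<in>I. ennreal t < min (distr_fun x r) (distr_fun y s)}"
      by (rule emeasure_initial[symmetric]) (rule min.coboundedI1[OF distr_fun_le])
    finally show ?thesis
      using rs by (simp add: less_erearr_iff x y ennreal_less_iff)
  qed
  have "(\<integral>\<^sup>+t. ennreal \<bar>x t * y t\<bar> \<partial>lebesgue_on I) = (\<integral>\<^sup>+t. ennreal \<bar>x t\<bar> * ennreal \<bar>y t\<bar> \<partial>lebesgue_on I)"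
    by (simp add: abs_mult ennreal_mult)
  also have "\<dots> \<le> (\<integral>\<^sup>+t. erearr x t * erearr y t \<partial>lebesgue_on I)"
    by (subst (1 2) layer_cake2, measurable)
      (auto intro!: le nn_integral_mono split: split_indicator)
  finally show ?thesis .
qed

end

section \<open>Resonance\<close>

text \<open>Since s/(1+s) lies strictly between 0 and 1, equality of the differences forces m = n.
  This makes the key in \<open>resonance_simple\<close> injective.\<close>

lemma inj_frac_minus_nat:
  fixes m n :: nat
  assumes "0 < s" "0 < t" and eq: "s / (1 + s) - real m = t / (1 + t) - real n"
  shows "s = t"
proof -
  have f: "0 < s / (1 + s)" "s / (1 + s) < 1" "0 < t / (1 + t)" "t / (1 + t) < 1"
    using assms by (auto simp: divide_simps)
  have "\<bar>real m - real n\<bar> < 1" using eq f by linarith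
  then have "m = n" by linarith
  then have "s / (1 + s) = t / (1 + t)" using eq by simp
  then show ?thesis using assms by (simp add: field_simps)
qed

context initial_interval
begin

text \<open>
  Ordering the support of \<open>u\<close> by decreasing values, with ties broken by position, is the same as ordering it
  by an injective key \<open>k\<close>. The measure \<open>\<sigma> s\<close> of the points preceding \<open>s\<close> is then a measure preserving
  map onto an initial interval with \<open>u = u\<^sup>* \<circ> \<sigma>\<close> almost everywhere, and \<open>w = z \<circ> \<sigma>\<close> is arranged like \<open>u\<close>.
\<close>

lemma resonance_simple:
  fixes u z :: "real \<Rightarrow> real"
  assumes u: "u \<in> L0 I" and u0: "\<And>s. 0 \<le> u s" and fin: "finite (u ` I)"
    and supp: "\<And>s. s \<in> I \<Longrightarrow> b < s \<Longrightarrow> u s = 0"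
    and z0: "\<And>t. t \<in> I \<Longrightarrow> 0 \<le> z t" and z: "antimono_on I z"
  obtains w where "w \<in> L0 I" "\<And>t. 0 \<le> w t" "\<And>t. t \<in> I \<Longrightarrow> rearr I w t \<le> ereal (z t)"
    "(\<integral>\<^sup>+t. erearr u t * ennreal (z t) \<partial>lebesgue_on I) \<le> (\<integral>\<^sup>+t. ennreal (u t * w t) \<partial>lebesgue_on I)"
proof -
  \<comment> \<open>F contains the support of u in I and has finite measure, as a distribution
    function requires.\<close>
  define F where "F = I \<inter> {..b}"
  have [measurable]: "F \<in> sets borel" by (simp add: F_def)
  have FI: "F \<subseteq> I" by (auto simp: F_def)
  define M where "M = lebesgue_on F"
  have spM [simp]: "space M = F" by (simp add: M_def)
  have emM: "emeasure M A = emeasure lebesgue A" if "A \<subseteq> F" for A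
    unfolding M_def using that by (simp add: emeasure_restrict_space)
  have emM_I: "emeasure M A = emeasure (lebesgue_on I) A" if "A \<subseteq> F" for A
    using emM[OF that] emeasure_on_I[of A] that FI by (simp add: subset_trans)
  interpret M: finite_measure M
  proof
    have "emeasure lebesgue F \<le> emeasure lebesgue {0..b}"
      by (rule emeasure_mono) (use I_cases in \<open>auto simp: F_def\<close>)
    also have "\<dots> < \<infinity>" by (auto simp: emeasure_lborel_Icc_eq)
    finally show "emeasure M (space M) \<noteq> \<infinity>" by (simp add: emM)
  qed
  have M_I: "f \<in> borel_measurable M" if "f \<in> borel_measurable (lebesgue_on I)" for f :: "real \<Rightarrow> real"
    unfolding M_def using that FI by (rule measurable_restrict_mono)
  have id_M [measurable]: "(\<lambda>s. s) \<in> borel_measurable M"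
    unfolding M_def by (intro measurable_restrict_space1 measurable_completion) auto
  \<comment> \<open>Finiteness of the range of u allows its values to be replaced by integers in the
    same order.\<close>
  define rank where "rank a = card {c \<in> u ` I. c < a}" for a
  have rank_less: "rank (u s) < rank (u s')" if "u s < u s'" "s \<in> I" for s s'
    unfolding rank_def using that fin by (intro psubset_card_mono) auto
  have "mono (\<lambda>a. real (rank a))"
    unfolding rank_def using fin by (intro monoI of_nat_mono card_mono) auto
  then have [measurable]: "(\<lambda>a. real (rank a)) \<in> borel_measurable borel"
    by (rule borel_measurable_mono)
  have [measurable]: "u \<in> borel_measurable M" using u by (intro M_I) (simp add: L0_def)
  \<comment> \<open>A larger value of u lowers the key by at least 1, more than s/(1+s) can
    compensate, so larger values come earlier; equal values are ordered by position. Level sets of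
    the injective key have at most one point, hence its image measure has no atoms.\<close>
  define k where "k s = s / (1 + s) - real (rank (u s))" for s
  have k_meas [measurable]: "k \<in> borel_measurable M"
    unfolding k_def[abs_def] by measurable
  have k_mono: "k s' \<le> k s" if "s \<in> F" "s' \<in> F" "u s < u s'" for s s'
  proof -
    have "0 < s" "0 < s'" using that FI by (auto simp: mem_I_iff)
    then have "0 < s / (1 + s)" "s' / (1 + s') < 1" by (auto simp: divide_simps)
    moreover have "real (rank (u s)) + 1 \<le> real (rank (u s'))"
      using rank_less[OF that(3)] that(1) FI by auto
    ultimately show ?thesis by (simp add: k_def)
  qed
  have k_inj: "inj_on k F"
  proof (rule inj_onI)
    fix s s' assume *: "s \<in> F" "s' \<in> F" "k s = k s'"
    then have "0 < s" "0 < s'" using FI by (auto simp: mem_I_iff)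
    then show "s = s'" using * by (auto simp: k_def intro: inj_frac_minus_nat)
  qed
  define P where "P = distr M borel k"
  interpret P: finite_borel_measure P
    by (intro finite_borel_measure.intro finite_borel_measure_axioms.intro)
      (auto simp: P_def intro!: M.finite_measure_distr)
  have atomless: "measure P {x} = 0" for x
  proof -
    have "measure P {x} = measure M {s\<in>F. k s = x}"
      unfolding P_def by (subst measure_distr) (auto simp: vimage_def Int_def conj_commute)
    also have "\<dots> = 0"
    proof (cases "\<exists>s\<in>F. k s = x")
      case True
      then obtain s where "s \<in> F" "k s = x" by auto
      then have "{s\<in>F. k s = x} = {s}" using k_inj by (auto dest: inj_onD)
      then show ?thesis using \<open>s \<in> F\<close> by (simp add: measure_def emM)
    next
      case False
      then have "{s\<in>F. k s = x} = {}" by auto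
      then show ?thesis by (simp only: measure_empty)
    qed
    finally show ?thesis .
  qed
  define \<sigma> where "\<sigma> s = cdf P (k s)" for s
  have cdf_meas [measurable]: "cdf P \<in> borel_measurable borel"
    by (intro borel_measurable_mono monoI P.cdf_nondecreasing)
  have sigma_meas [measurable]: "\<sigma> \<in> borel_measurable M"
    unfolding \<sigma>_def[abs_def] by measurable
  have sigma_eq: "ennreal (\<sigma> s) = emeasure M {s'\<in>F. k s' \<le> k s}" for s
  proof -
    have "\<sigma> s = measure M {s'\<in>F. k s' \<le> k s}"
      unfolding \<sigma>_def cdf_def P_def by (subst measure_distr) (auto simp: vimage_def Int_def conj_commute)
    then show ?thesis by (simp add: M.emeasure_eq_measure)
  qed
  define m where "m = measure M F"
  have "measure P (space P) = m"
    unfolding P_def m_def by (subst measure_distr) auto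
  then have distr_sigma: "distr M borel \<sigma> = density lborel (indicator {0<..<m})"
    using P.distr_cdf[OF atomless] distr_distr[OF cdf_meas k_meas]
    by (simp add: P_def[symmetric] \<sigma>_def[abs_def] comp_def)
  have push: "(\<integral>\<^sup>+s. g (\<sigma> s) \<partial>M) = (\<integral>\<^sup>+t. indicator {0<..<m} t * g t \<partial>lborel)"
    if [measurable]: "g \<in> borel_measurable borel" for g :: "real \<Rightarrow> ennreal"
  proof -
    have "(\<integral>\<^sup>+s. g (\<sigma> s) \<partial>M) = (\<integral>\<^sup>+t. g t \<partial>distr M borel \<sigma>)"
      by (subst nn_integral_distr) auto
    also have "\<dots> = (\<integral>\<^sup>+t. indicator {0<..<m} t * g t \<partial>lborel)"
      unfolding distr_sigma by (subst nn_integral_density) auto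
    finally show ?thesis .
  qed
  \<comment> \<open>On a null set \<sigma> may take values outside I, such as 0 or an endpoint of
    (0,1). The extension of z by 0 makes the composition with \<sigma> meaningful and
    measurable.\<close>
  define z' where "z' t = indicator I t * z t" for t
  have z'0: "0 \<le> z' t" for t using z0 by (simp add: z'_def split: split_indicator)
  have [measurable]: "z' \<in> borel_measurable borel"
    using borel_measurable_antimono_on[OF is_interval_I z]
    unfolding z'_def[abs_def] by (simp add: borel_measurable_restrict_space_iff)
  define w where "w s = indicator F s * z' (\<sigma> s)" for s
  have w0: "0 \<le> w s" for s using z'0 by (simp add: w_def)
  have w_meas: "w \<in> L0 I"
  proof -
    have "(\<lambda>s. z' (\<sigma> s)) \<in> borel_measurable (restrict_space lebesgue F)"
      unfolding M_def[symmetric] by measurable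
    then have "w \<in> borel_measurable lebesgue"
      unfolding w_def[abs_def] by (subst (asm) borel_measurable_restrict_space_iff) simp_all
    then show ?thesis unfolding L0_def by (rule measurable_restrict_space1)
  qed
  \<comment> \<open>If this failed at t, then w would exceed z t on a set of measure greater than t.
    As z is decreasing, \<sigma> maps that set into (0,t), and by \<open>push\<close> its measure is
    at most t.\<close>
  have w_le: "rearr I w t \<le> ereal (z t)" if t: "t \<in> I" for t
  proof (rule ccontr)
    assume "\<not> rearr I w t \<le> ereal (z t)"
    then have "ennreal t < distr_fun w (z t)"
      using less_rearr_iff[OF w_meas z0[OF t]] by (simp add: not_le)
    also have "distr_fun w (z t) = emeasure M {s\<in>F. z t < z' (\<sigma> s)}"
    proof -
      have "{s\<in>I. z t < \<bar>w s\<bar>} = {s\<in>F. z t < z' (\<sigma> s)}"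
        using z0[OF t] z'0 FI by (auto simp: w_def split: split_indicator_asm)
      then show ?thesis unfolding distr_fun_def by (simp add: emM_I)
    qed
    also have "\<dots> \<le> emeasure M {s\<in>space M. \<sigma> s \<in> {0<..<t}}"
    proof (rule emeasure_mono)
      show "{s\<in>F. z t < z' (\<sigma> s)} \<subseteq> {s\<in>space M. \<sigma> s \<in> {0<..<t}}"
      proof safe
        fix s assume s: "s \<in> F" "z t < z' (\<sigma> s)"
        then have *: "\<sigma> s \<in> I" "z t < z (\<sigma> s)"
          using z0[OF t] by (auto simp: z'_def split: split_indicator_asm)
        then have "\<not> t \<le> \<sigma> s" using z t by (auto dest: monotone_onD)
        then show "\<sigma> s \<in> {0<..<t}" using * by (auto simp: mem_I_iff)
      qed (simp add: M_def)
      show "{s \<in> space M. \<sigma> s \<in> {0<..<t}} \<in> sets M" by measurable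
    qed
    also have "\<dots> = (\<integral>\<^sup>+s. indicator {0<..<t} (\<sigma> s) \<partial>M)"
      by (subst nn_integral_indicator[symmetric]) (measurable, auto intro!: nn_integral_cong split: split_indicator)
    also have "\<dots> = (\<integral>\<^sup>+s. indicator {0<..<m} s * indicator {0<..<t} s \<partial>lborel)"
      by (rule push) measurable
    also have "\<dots> \<le> (\<integral>\<^sup>+s. indicator {0<..<t} s \<partial>lborel)"
      by (intro nn_integral_mono) (auto split: split_indicator)
    also have "\<dots> = ennreal t" using t by (simp add: mem_I_iff)
    finally show False by simp
  qed
  \<comment> \<open>All points with a value of u above u s precede s, so their measure is at most
    \<sigma> s. This half of the relation between u and its rearrangement holds everywhere on F and
    suffices for the final estimate.\<close>
  have erearr_sigma: "erearr u (\<sigma> s) \<le> ennreal (u s)" if s: "s \<in> F" for s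
  proof (rule ccontr)
    assume "\<not> erearr u (\<sigma> s) \<le> ennreal (u s)"
    then have "ennreal (\<sigma> s) < distr_fun u (u s)"
      using less_erearr_iff[OF u u0] by (simp add: not_le)
    also have "distr_fun u (u s) = emeasure M {s'\<in>I. u s < u s'}"
    proof -
      have "{s'\<in>I. u s < u s'} \<subseteq> F"
        using supp u0[of s] by (force simp: F_def not_le[symmetric])
      then show ?thesis unfolding distr_fun_def using u0 by (simp add: emM_I)
    qed
    also have "\<dots> \<le> emeasure M {s'\<in>space M. k s' \<le> k s}"
    proof (rule emeasure_mono)
      show "{s'\<in>I. u s < u s'} \<subseteq> {s'\<in>space M. k s' \<le> k s}"
      proof safe
        fix s' assume s': "s' \<in> I" "u s < u s'"
        then show "s' \<in> space M" using supp[of s'] u0[of s] by (force simp: F_def)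
        then show "k s' \<le> k s" using s s' by (intro k_mono) auto
      qed
      show "{s'\<in>space M. k s' \<le> k s} \<in> sets M" by measurable
    qed
    also have "\<dots> = ennreal (\<sigma> s)" by (simp add: sigma_eq)
    finally show False by simp
  qed
  \<comment> \<open>The support of u has measure at most m, so the integral lives on (0,m), the
    range on which \<open>push\<close> transports it to F.\<close>
  have erearr_0: "erearr u t = 0" if t: "m \<le> t" for t
  proof (rule ccontr)
    assume "erearr u t \<noteq> 0"
    then have "ennreal t < distr_fun u 0"
      using less_erearr_iff[OF u, of 0 t] by (simp add: zero_less_iff_neq_zero)
    also have "distr_fun u 0 = emeasure M {s\<in>I. 0 < u s}"
    proof -
      have "{s\<in>I. 0 < u s} \<subseteq> F"
        using supp by (force simp: F_def not_le[symmetric])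
      then show ?thesis unfolding distr_fun_def using u0 by (simp add: emM_I)
    qed
    also have "\<dots> \<le> emeasure M F"
      using emeasure_space[of M] by simp
    also have "\<dots> = ennreal m" by (simp add: m_def M.emeasure_eq_measure)
    also have "\<dots> \<le> ennreal t" using t by (rule ennreal_leI)
    finally show False by simp
  qed
  have [measurable]: "erearr u \<in> borel_measurable borel"
    using borel_measurable_antimono_on[of UNIV "erearr u"] erearr_antimono
    by (simp add: monotone_on_def borel_measurable_restrict_space_iff_ennreal)
  have "(\<integral>\<^sup>+t. erearr u t * ennreal (z t) \<partial>lebesgue_on I)
      = (\<integral>\<^sup>+t. erearr u t * ennreal (z' t) \<partial>lebesgue)"
    by (subst nn_integral_restrict_space) (auto intro!: nn_integral_cong simp: z'_def split: split_indicator)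
  also have "\<dots> = (\<integral>\<^sup>+t. erearr u t * ennreal (z' t) \<partial>lborel)"
    by (rule nn_integral_completion)
  also have "\<dots> = (\<integral>\<^sup>+t. indicator {0<..<m} t * (erearr u t * ennreal (z' t)) \<partial>lborel)"
    by (intro nn_integral_cong) (auto simp: z'_def mem_I_iff erearr_0 split: split_indicator)
  also have "\<dots> = (\<integral>\<^sup>+s. erearr u (\<sigma> s) * ennreal (z' (\<sigma> s)) \<partial>M)"
    by (rule push[symmetric]) measurable
  also have "\<dots> \<le> (\<integral>\<^sup>+s. ennreal (u s * w s) \<partial>M)"
    by (intro nn_integral_mono) (auto simp: w_def ennreal_mult u0 z'0 intro!: mult_right_mono erearr_sigma)
  also have "\<dots> = (\<integral>\<^sup>+s. ennreal (u s * w s) \<partial>lebesgue_on I)"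
    unfolding M_def using FI
    by (subst (1 2) nn_integral_restrict_space) (auto intro!: nn_integral_cong simp: w_def split: split_indicator)
  finally show thesis using that w_meas w0 w_le by blast
qed

text \<open>A common bound B for all admissible w expresses the supremum without asking that it be
  attained. Each simple function below |x| has its own w from \<open>resonance_simple\<close>, and
  monotone convergence of the rearrangements gives the bound for x.\<close>

theorem resonance:
  assumes x: "x \<in> L0 I"
    and z0: "\<And>t. t \<in> I \<Longrightarrow> 0 \<le> z t" and z: "antimono_on I z"
    and B: "\<And>w. w \<in> L0 I \<Longrightarrow> (\<And>t. 0 \<le> w t) \<Longrightarrow> (\<And>t. t \<in> I \<Longrightarrow> rearr I w t \<le> ereal (z t)) \<Longrightarrow>
      (\<integral>\<^sup>+t. ennreal \<bar>x t * w t\<bar> \<partial>lebesgue_on I) \<le> B"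
  shows "(\<integral>\<^sup>+t. erearr x t * ennreal (z t) \<partial>lebesgue_on I) \<le> B"
proof -
  have "(\<lambda>s. ennreal \<bar>x s\<bar>) \<in> borel_measurable (lebesgue_on I)"
    using x by (auto simp: L0_def)
  then obtain f where f: "\<And>n. simple_function (lebesgue_on I) (f n)" "incseq f"
      "\<And>n s. f n s < top" "\<And>s. (SUP n. f n s) = ennreal \<bar>x s\<bar>"
    using borel_measurable_implies_simple_function_sequence' by blast
  \<comment> \<open>The cutoff at n provides the bounded support demanded by
    \<open>resonance_simple\<close>; it moves out with n, so the sequence still increases to |x| on
    I.\<close>
  define u where "u n s = enn2real (f n s) * indicator {..real n} s" for n s
  have u0: "0 \<le> u n s" for n s by (simp add: u_def)
  have [measurable]: "f n \<in> borel_measurable (lebesgue_on I)" for n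
    using f(1) by (rule borel_measurable_simple_function)
  have [measurable]: "(\<lambda>s. s) \<in> borel_measurable (lebesgue_on I)"
    by (intro measurable_restrict_space1 measurable_completion) auto
  have u_L0: "u n \<in> L0 I" for n
    unfolding u_def[abs_def] L0_def by measurable
  have u_fin: "finite (u n ` I)" for n
  proof (rule finite_subset)
    show "u n ` I \<subseteq> insert 0 (enn2real ` f n ` I)"
      by (auto simp: u_def split: split_indicator)
    show "finite (insert 0 (enn2real ` f n ` I))"
      using simple_functionD(1)[OF f(1)[of n]] by simp
  qed
  have f_real: "ennreal (enn2real (f n s)) = f n s" for n s
    using f(3)[of n s] by (simp add: less_top)
  have u_le: "u n s \<le> \<bar>x s\<bar>" for n s
  proof -
    have "ennreal (enn2real (f n s)) \<le> ennreal \<bar>x s\<bar>"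
      unfolding f_real f(4)[symmetric] by (rule SUP_upper) simp
    then show ?thesis by (auto simp: u_def split: split_indicator)
  qed
  have u_mono: "u n s \<le> u (Suc n) s" for n s
  proof -
    have "f n s \<le> f (Suc n) s" using f(2) by (auto simp: incseq_Suc_iff le_fun_def)
    then have "enn2real (f n s) \<le> enn2real (f (Suc n) s)"
      using f(3) by (intro enn2real_mono) auto
    then show ?thesis by (auto simp: u_def split: split_indicator)
  qed
  then have u_inc: "incseq (\<lambda>n. u n s)" for s by (rule incseq_SucI)
  have u_lim: "\<exists>n. r < u n s" if "r < \<bar>x s\<bar>" "0 \<le> r" for r s
  proof -
    have "ennreal r < (SUP n. f n s)" using that by (simp add: f(4) ennreal_less_iff)
    then obtain n where "ennreal r < f n s" by (auto simp: less_SUP_iff)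
    then have "r < enn2real (f n s)" using f_real[of n s] that by (metis ennreal_less_iff)
    moreover obtain n' where "s \<le> real n'" using real_arch_simple by blast
    moreover have "enn2real (f n s) \<le> enn2real (f (max n n') s)"
      using incseqD[OF f(2), of n "max n n'"] f(3) by (intro enn2real_mono) (auto simp: le_fun_def)
    ultimately have "r < u (max n n') s" by (auto simp: u_def split: split_indicator)
    then show ?thesis ..
  qed
  have distr_lim: "distr_fun x r = (SUP n. distr_fun (u n) r)" if r: "0 \<le> r" for r
  proof -
    have "(SUP n. distr_fun (u n) r) = emeasure (lebesgue_on I) (\<Union>n. {s\<in>I. r < \<bar>u n s\<bar>})"
      unfolding distr_fun_def
      by (rule SUP_emeasure_incseq)
        (use sets_level[OF u_L0] u0 in \<open>auto intro!: incseq_SucI intro: less_le_trans u_mono\<close>)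
    also have "(\<Union>n. {s\<in>I. r < \<bar>u n s\<bar>}) = {s\<in>I. r < \<bar>x s\<bar>}"
      using u_lim[OF _ r] u_le u0 by (auto intro: less_le_trans)
    finally show ?thesis by (simp add: distr_fun_def)
  qed
  have le_x: "erearr (u n) t \<le> erearr x t" for n t
    unfolding erearr_def using u_le u0
    by (intro e2ennreal_mono rearr_mono_AE u_L0 x) auto
  \<comment> \<open>Superlevel sets are continuous along increasing sequences, and
    \<open>less_erearr_iff\<close> carries the convergence of distribution functions over to
    rearrangements.\<close>
  have sup: "(SUP n. erearr (u n) t) = erearr x t" for t
  proof (rule antisym)
    show "erearr x t \<le> (SUP n. erearr (u n) t)"
    proof (rule dense_le)
      fix a assume a: "a < erearr x t"
      then obtain r where r: "a = ennreal r" "0 \<le> r" by (cases a) auto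
      then have "ennreal t < (SUP n. distr_fun (u n) r)"
        using a less_erearr_iff[OF x] distr_lim by simp
      then obtain n where "ennreal t < distr_fun (u n) r" by (auto simp: less_SUP_iff)
      then have "a < erearr (u n) t" using r less_erearr_iff[OF u_L0] by simp
      also have "\<dots> \<le> (SUP n. erearr (u n) t)" by (rule SUP_upper) simp
      finally show "a \<le> (SUP n. erearr (u n) t)" by simp
    qed
  qed (auto intro: SUP_least le_x)
  have [measurable]: "z \<in> borel_measurable (lebesgue_on I)"
    by (rule borel_measurable_lebesgue_on_antimono_on[OF is_interval_I z])
  have "(\<integral>\<^sup>+t. erearr x t * ennreal (z t) \<partial>lebesgue_on I)
      = (\<integral>\<^sup>+t. (SUP n. erearr (u n) t * ennreal (z t)) \<partial>lebesgue_on I)"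
    by (simp add: sup flip: SUP_mult_right_ennreal)
  also have "\<dots> = (SUP n. \<integral>\<^sup>+t. erearr (u n) t * ennreal (z t) \<partial>lebesgue_on I)"
  proof (rule nn_integral_monotone_convergence_SUP)
    show "incseq (\<lambda>n t. erearr (u n) t * ennreal (z t))"
      unfolding erearr_def using u_mono u0
      by (intro incseq_SucI le_funI mult_right_mono e2ennreal_mono rearr_mono_AE u_L0) auto
  qed measurable
  also have "\<dots> \<le> B"
  proof (rule SUP_least)
    fix n
    obtain w where w: "w \<in> L0 I" "\<And>t. 0 \<le> w t" "\<And>t. t \<in> I \<Longrightarrow> rearr I w t \<le> ereal (z t)"
      "(\<integral>\<^sup>+t. erearr (u n) t * ennreal (z t) \<partial>lebesgue_on I) \<le> (\<integral>\<^sup>+t. ennreal (u n t * w t) \<partial>lebesgue_on I)"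
    proof (rule resonance_simple[OF u_L0 u0 u_fin _ z0 z])
      show "u n s = 0" if "real n < s" for s using that by (simp add: u_def)
    qed blast+
    note w(4)
    also have "(\<integral>\<^sup>+t. ennreal (u n t * w t) \<partial>lebesgue_on I) \<le> (\<integral>\<^sup>+t. ennreal \<bar>x t * w t\<bar> \<partial>lebesgue_on I)"
      using u_le w(2) by (intro nn_integral_mono ennreal_leI) (auto simp: abs_mult intro!: mult_right_mono)
    also have "\<dots> \<le> B" by (rule B[OF w(1-3)])
    finally show "(\<integral>\<^sup>+t. erearr (u n) t * ennreal (z t) \<partial>lebesgue_on I) \<le> B" .
  qed
  finally show ?thesis .
qed

section \<open>The operator H* and integrals against decreasing functions\<close>

lemma ennreal_Hstar:
  assumes "t \<in> I" "\<And>s. 0 \<le> y s" "set_integrable lebesgue ({t<..} \<inter> I) (\<lambda>s. y s / s)"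
  shows "ennreal (Hstar I y t) = (\<integral>\<^sup>+s. indicator {t<..} s * ennreal (y s / s) \<partial>lebesgue_on I)"
    and "0 \<le> Hstar I y t"
proof -
  have nn: "0 \<le> indicator ({t<..} \<inter> I) s *\<^sub>R (y s / s)" for s
    using assms(2) by (auto simp: mem_I_iff split: split_indicator)
  then show "0 \<le> Hstar I y t"
    unfolding Hstar_def set_lebesgue_integral_def by (intro Bochner_Integration.integral_nonneg)
  have "ennreal (Hstar I y t) = (\<integral>\<^sup>+s. ennreal (indicator ({t<..} \<inter> I) s *\<^sub>R (y s / s)) \<partial>lebesgue)"
    unfolding Hstar_def set_lebesgue_integral_def
    using assms(3) nn by (intro nn_integral_eq_integral[symmetric]) (auto simp: set_integrable_def)
  also have "\<dots> = (\<integral>\<^sup>+s. indicator {t<..} s * ennreal (y s / s) \<partial>lebesgue_on I)"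
    by (subst nn_integral_restrict_space) (auto intro!: nn_integral_cong split: split_indicator)
  finally show "ennreal (Hstar I y t) = (\<integral>\<^sup>+s. indicator {t<..} s * ennreal (y s / s) \<partial>lebesgue_on I)" .
qed

lemma Hstar_antimono:
  assumes "\<And>s. 0 \<le> y s" "\<And>t. t \<in> I \<Longrightarrow> set_integrable lebesgue ({t<..} \<inter> I) (\<lambda>s. y s / s)"
  shows "antimono_on I (Hstar I y)"
proof (rule monotone_onI)
  fix t t' assume t: "t \<in> I" "t' \<in> I" "t \<le> t'"
  have "ennreal (Hstar I y t') \<le> ennreal (Hstar I y t)"
    using ennreal_Hstar(1)[of _ y] t assms
    by (auto intro!: nn_integral_mono mult_right_mono split: split_indicator)
  then show "Hstar I y t' \<le> Hstar I y t"
    using ennreal_Hstar(2)[of t y] t assms by simp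
qed

text \<open>Write y(s) as the integral of y(s)/s over t in (0,s). Replacing the rearrangement at s
  by its larger value at t and exchanging the integrals leaves, for fixed t, the integral of y(s)/s
  over s > t, which is H*y at t.\<close>

lemma erearr_le_Hstar:
  assumes y: "y \<in> L0 I" "\<And>s. 0 \<le> y s"
    and int: "\<And>t. t \<in> I \<Longrightarrow> set_integrable lebesgue ({t<..} \<inter> I) (\<lambda>s. y s / s)"
  shows "(\<integral>\<^sup>+t. erearr x t * ennreal (y t) \<partial>lebesgue_on I)
    \<le> (\<integral>\<^sup>+t. erearr x t * ennreal (Hstar I y t) \<partial>lebesgue_on I)"
proof -
  interpret pair_sigma_finite "lebesgue_on I" "lebesgue_on I" ..
  note [measurable] = y(1)
  have id_meas [measurable]: "(\<lambda>s. s) \<in> borel_measurable (lebesgue_on I)"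
    by (intro measurable_restrict_space1 measurable_completion) auto
  let ?h = "\<lambda>t s. erearr x t * (indicator {..<s} t * ennreal (y s / s))"
  have m: "case_prod ?h \<in> borel_measurable (lebesgue_on I \<Otimes>\<^sub>M lebesgue_on I)"
  proof -
    have id: "(\<lambda>p. fst p) \<in> borel_measurable (lebesgue_on I \<Otimes>\<^sub>M lebesgue_on I)"
      "(\<lambda>p. snd p) \<in> borel_measurable (lebesgue_on I \<Otimes>\<^sub>M lebesgue_on I)"
      using measurable_compose[OF measurable_fst id_meas] measurable_compose[OF measurable_snd id_meas]
      by auto
    have "{p\<in>space (lebesgue_on I \<Otimes>\<^sub>M lebesgue_on I). fst p < snd p}
        \<in> sets (lebesgue_on I \<Otimes>\<^sub>M lebesgue_on I)"
      using id by (rule borel_measurable_less)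
    moreover have "(\<lambda>s. y s / s) \<in> borel_measurable (lebesgue_on I)" by measurable
    from measurable_compose[OF measurable_snd this]
    have "(\<lambda>p. y (snd p) / snd p) \<in> borel_measurable (lebesgue_on I \<Otimes>\<^sub>M lebesgue_on I)" .
    ultimately show ?thesis
      by (auto simp: split_beta' pred_def intro!: borel_measurable_times_ennreal borel_measurable_indicator')
  qed
  have "(\<integral>\<^sup>+s. erearr x s * ennreal (y s) \<partial>lebesgue_on I) \<le> (\<integral>\<^sup>+s. (\<integral>\<^sup>+t. ?h t s \<partial>lebesgue_on I) \<partial>lebesgue_on I)"
  proof (rule nn_integral_mono)
    fix s assume "s \<in> space (lebesgue_on I)"
    then have s: "s \<in> I" "0 < s" by (auto simp: mem_I_iff)
    have "emeasure (lebesgue_on I) {0<..<s} = ennreal s"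
      using s I_down[OF s(1)] by (subst emeasure_on_I) auto
    moreover have "{0<..<s} \<in> sets (lebesgue_on I)"
      using I_down[OF s(1)] by (auto simp: sets_restrict_space_iff)
    ultimately have "(\<integral>\<^sup>+t. (erearr x s * ennreal (y s / s)) * indicator {0<..<s} t \<partial>lebesgue_on I)
        = erearr x s * ennreal (y s / s) * ennreal s"
      by (subst nn_integral_cmult_indicator) auto
    also have "\<dots> = erearr x s * ennreal (y s)"
      using s y(2) by (simp add: mult.assoc flip: ennreal_mult)
    finally have "erearr x s * ennreal (y s) =
      (\<integral>\<^sup>+t. (erearr x s * ennreal (y s / s)) * indicator {0<..<s} t \<partial>lebesgue_on I)" ..
    also have "\<dots> \<le> (\<integral>\<^sup>+t. ?h t s \<partial>lebesgue_on I)"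
      by (intro nn_integral_mono) (auto intro!: mult_right_mono erearr_antimono split: split_indicator)
    finally show "erearr x s * ennreal (y s) \<le> (\<integral>\<^sup>+t. ?h t s \<partial>lebesgue_on I)" .
  qed
  also have "\<dots> = (\<integral>\<^sup>+t. (\<integral>\<^sup>+s. ?h t s \<partial>lebesgue_on I) \<partial>lebesgue_on I)"
    by (rule Fubini'[OF m])
  also have "\<dots> = (\<integral>\<^sup>+t. erearr x t * ennreal (Hstar I y t) \<partial>lebesgue_on I)"
  proof (rule nn_integral_cong)
    fix t assume "t \<in> space (lebesgue_on I)"
    then have t: "t \<in> I" by simp
    have "(\<integral>\<^sup>+s. ?h t s \<partial>lebesgue_on I)
        = (\<integral>\<^sup>+s. erearr x t * (indicator {t<..} s * ennreal (y s / s)) \<partial>lebesgue_on I)"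
      by (intro nn_integral_cong) (auto split: split_indicator)
    also have "\<dots> = erearr x t * ennreal (Hstar I y t)"
      using ennreal_Hstar(1)[OF t y(2) int[OF t]] by (simp add: nn_integral_cmult)
    finally show "(\<integral>\<^sup>+s. ?h t s \<partial>lebesgue_on I) = erearr x t * ennreal (Hstar I y t)" .
  qed
  finally show ?thesis .
qed

end

section \<open>Koethe duals of symmetrizations\<close>

lemma quasi_norm_onI:
  assumes "linear_subspace_L0 I X"
    and "\<And>x y. x \<in> X \<Longrightarrow> y \<in> X \<Longrightarrow> AE t in lebesgue_on I. x t = y t \<Longrightarrow> M x = M y"
    and "\<And>x. x \<in> X \<Longrightarrow> 0 \<le> M x"
    and "\<And>x. x \<in> X \<Longrightarrow> M x = 0 \<longleftrightarrow> (AE t in lebesgue_on I. x t = 0)"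
    and "\<And>c x. x \<in> X \<Longrightarrow> M (\<lambda>t. c * x t) = \<bar>c\<bar> * M x"
    and "\<And>x y. x \<in> X \<Longrightarrow> y \<in> X \<Longrightarrow> M (\<lambda>t. x t + y t) \<le> C * (M x + M y)"
    and "1 \<le> C"
  shows "quasi_norm_on I X M"
  unfolding quasi_norm_on_def
  by (intro conjI ballI allI impI exI[of _ C]; rule assms; assumption)

context initial_interval
begin

lemma kothe_ennorm_upper:
  "y \<in> X \<Longrightarrow> M y \<le> 1 \<Longrightarrow> (\<integral>\<^sup>+t. ennreal \<bar>x t * y t\<bar> \<partial>lebesgue_on I) \<le> kothe_ennorm I X M x"
  unfolding kothe_ennorm_def by (rule SUP_upper) simp

lemma kothe_ennorm_add:
  assumes X: "X \<subseteq> L0 I" and [measurable]: "x \<in> L0 I" "y \<in> L0 I"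
  shows "kothe_ennorm I X M (\<lambda>t. x t + y t) \<le> kothe_ennorm I X M x + kothe_ennorm I X M y"
proof (subst kothe_ennorm_def, rule SUP_least)
  fix v assume v: "v \<in> {v \<in> X. M v \<le> 1}"
  then have [measurable]: "v \<in> L0 I" using X by auto
  have "(\<integral>\<^sup>+t. ennreal \<bar>(x t + y t) * v t\<bar> \<partial>lebesgue_on I)
      \<le> (\<integral>\<^sup>+t. ennreal \<bar>x t * v t\<bar> + ennreal \<bar>y t * v t\<bar> \<partial>lebesgue_on I)"
    by (intro nn_integral_mono) (simp add: distrib_right abs_triangle_ineq flip: ennreal_plus)
  also have "\<dots> = (\<integral>\<^sup>+t. ennreal \<bar>x t * v t\<bar> \<partial>lebesgue_on I) + (\<integral>\<^sup>+t. ennreal \<bar>y t * v t\<bar> \<partial>lebesgue_on I)"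
    by (rule nn_integral_add) measurable
  also have "\<dots> \<le> kothe_ennorm I X M x + kothe_ennorm I X M y"
    using v by (intro add_mono kothe_ennorm_upper) auto
  finally show "(\<integral>\<^sup>+t. ennreal \<bar>(x t + y t) * v t\<bar> \<partial>lebesgue_on I)
    \<le> kothe_ennorm I X M x + kothe_ennorm I X M y" .
qed

lemma kothe_ennorm_scale:
  assumes X: "X \<subseteq> L0 I" and [measurable]: "x \<in> L0 I"
    and ne: "X \<noteq> {}"
  shows "kothe_ennorm I X M (\<lambda>t. c * x t) = ennreal \<bar>c\<bar> * kothe_ennorm I X M x"
proof -
  have "(\<integral>\<^sup>+t. ennreal \<bar>c * x t * v t\<bar> \<partial>lebesgue_on I)
      = ennreal \<bar>c\<bar> * (\<integral>\<^sup>+t. ennreal \<bar>x t * v t\<bar> \<partial>lebesgue_on I)" if "v \<in> X" for v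
  proof -
    have [measurable]: "v \<in> L0 I" using X that by auto
    show ?thesis
      by (subst nn_integral_cmult[symmetric]) (measurable, simp add: abs_mult mult.assoc ennreal_mult)
  qed
  then show ?thesis
    unfolding kothe_ennorm_def by (simp add: SUP_mult_left_ennreal)
qed

lemma kothe_ennorm_cong_AE:
  assumes "AE t in lebesgue_on I. \<bar>x t\<bar> = \<bar>y t\<bar>"
  shows "kothe_ennorm I X M x = kothe_ennorm I X M y"
  unfolding kothe_ennorm_def
  by (intro SUP_cong refl nn_integral_cong_AE) (use assms in \<open>auto simp: abs_mult\<close>)

end

locale ideal_on_interval = initial_interval +
  fixes E :: "(real \<Rightarrow> real) set" and N :: "(real \<Rightarrow> real) \<Rightarrow> real"
  assumes ideal_space: "quasi_normed_ideal_space I E N"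
    and symm_nonzero: "nonzero_space I (symm_set I E)"
begin

lemma E_L0: "x \<in> E \<Longrightarrow> x \<in> L0 I"
  using ideal_space
  unfolding quasi_normed_ideal_space_def quasi_norm_on_def linear_subspace_L0_def by blast

lemma E_scale: "x \<in> E \<Longrightarrow> (\<lambda>t. c * x t) \<in> E" "x \<in> E \<Longrightarrow> N (\<lambda>t. c * x t) = \<bar>c\<bar> * N x"
  using ideal_space
  unfolding quasi_normed_ideal_space_def quasi_norm_on_def linear_subspace_L0_def by blast+

lemma N_nonneg: "x \<in> E \<Longrightarrow> 0 \<le> N x"
  using ideal_space unfolding quasi_normed_ideal_space_def quasi_norm_on_def by blast

lemma E_ideal:
  assumes "y \<in> E" "x \<in> L0 I" "\<And>t. t \<in> I \<Longrightarrow> \<bar>x t\<bar> \<le> \<bar>y t\<bar>"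
  shows "x \<in> E" "N x \<le> N y"
proof -
  have "AE t in lebesgue_on I. \<bar>x t\<bar> \<le> \<bar>y t\<bar>" using assms(3) by (intro AE_I2) simp
  then show "x \<in> E" "N x \<le> N y"
    using ideal_space assms(1,2) unfolding quasi_normed_ideal_space_def by blast+
qed

abbreviation "symm_kothe_set \<equiv> symm_set I (kothe_set I E N)"
abbreviation "symm_kothe_norm \<equiv> symm_norm I (kothe_norm I E N)"
abbreviation "kothe_symm_set \<equiv> kothe_set I (symm_set I E) (symm_norm I N)"
abbreviation "kothe_symm_ennorm \<equiv> kothe_ennorm I (symm_set I E) (symm_norm I N)"
abbreviation "kothe_symm_norm \<equiv> kothe_norm I (symm_set I E) (symm_norm I N)"

lemma symm_set_L0: "symm_set I X \<subseteq> L0 I"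
  by (auto simp: symm_set_def)

lemma symm_set_ne: "symm_set I E \<noteq> {}"
  using symm_nonzero by (auto simp: nonzero_space_def)

text \<open>The ideal property of E, applied to the rearrangement of w and to z, is what admits the
  test functions of \<open>resonance\<close> to a ball of the symmetrization.\<close>

lemma symm_set_I:
  assumes w: "w \<in> L0 I" and z: "z \<in> E" and le: "\<And>t. t \<in> I \<Longrightarrow> rearr I w t \<le> ereal (z t)"
  shows "w \<in> symm_set I E" "symm_norm I N w \<le> N z"
proof -
  have "\<bar>rearr_real I w t\<bar> \<le> \<bar>z t\<bar>" if "t \<in> I" for t
    using le[OF that] rearr_nonneg[of w t]
    by (cases "rearr I w t") (auto simp: rearr_real_def)
  note r = E_ideal[OF z rearr_real_L0 this]
  have "AE t in lebesgue_on I. rearr I w t < \<infinity>"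
  proof (rule AE_I2)
    fix t assume "t \<in> space (lebesgue_on I)"
    then have "rearr I w t \<le> ereal (z t)" using le by simp
    also have "\<dots> < \<infinity>" by simp
    finally show "rearr I w t < \<infinity>" .
  qed
  then show "w \<in> symm_set I E" "symm_norm I N w \<le> N z"
    using w r by (auto simp: symm_set_def symm_norm_def)
qed

text \<open>Finiteness almost everywhere confines the default value 0 of \<open>rearr_real\<close>
  to a null set.\<close>

lemma nn_integral_rearr_real:
  assumes "AE t in lebesgue_on I. rearr I x t < \<infinity>"
  shows "(\<integral>\<^sup>+t. ennreal \<bar>rearr_real I x t * y t\<bar> \<partial>lebesgue_on I)
    = (\<integral>\<^sup>+t. erearr x t * ennreal \<bar>y t\<bar> \<partial>lebesgue_on I)"
proof (rule nn_integral_cong_AE)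
  show "AE t in lebesgue_on I. ennreal \<bar>rearr_real I x t * y t\<bar> = erearr x t * ennreal \<bar>y t\<bar>"
    using assms
  proof eventually_elim
    case (elim t)
    then have "erearr x t = ennreal \<bar>rearr_real I x t\<bar>"
      using rearr_real_nonneg[of x t] by (simp only: erearr_eq_rearr_real abs_of_nonneg)
    then show ?case by (simp add: abs_mult ennreal_mult)
  qed
qed

section \<open>The embedding that follows from the Hardy-Littlewood inequality\<close>

lemma kothe_symm_ennorm_le:
  assumes x: "x \<in> L0 I" "AE t in lebesgue_on I. rearr I x t < \<infinity>"
  shows "kothe_symm_ennorm x \<le> kothe_ennorm I E N (rearr_real I x)"
proof (subst kothe_ennorm_def, rule SUP_least)
  fix y assume "y \<in> {y \<in> symm_set I E. symm_norm I N y \<le> 1}"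
  then have y: "y \<in> L0 I" "AE t in lebesgue_on I. rearr I y t < \<infinity>" "rearr_real I y \<in> E" "N (rearr_real I y) \<le> 1"
    by (auto simp: symm_set_def symm_norm_def)
  have "(\<integral>\<^sup>+t. ennreal \<bar>x t * y t\<bar> \<partial>lebesgue_on I) \<le> (\<integral>\<^sup>+t. erearr x t * erearr y t \<partial>lebesgue_on I)"
    by (rule hardy_littlewood[OF x(1) y(1)])
  also have "\<dots> = (\<integral>\<^sup>+t. erearr x t * ennreal \<bar>rearr_real I y t\<bar> \<partial>lebesgue_on I)"
  proof (rule nn_integral_cong_AE)
    show "AE t in lebesgue_on I. erearr x t * erearr y t = erearr x t * ennreal \<bar>rearr_real I y t\<bar>"
      using y(2)
    proof eventually_elim
      case (elim t)
      then have "erearr y t = ennreal \<bar>rearr_real I y t\<bar>"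
        using rearr_real_nonneg[of y t] by (simp only: erearr_eq_rearr_real abs_of_nonneg)
      then show ?case by (simp only:)
    qed
  qed
  also have "\<dots> = (\<integral>\<^sup>+t. ennreal \<bar>rearr_real I x t * rearr_real I y t\<bar> \<partial>lebesgue_on I)"
    by (rule nn_integral_rearr_real[OF x(2), symmetric])
  \<comment> \<open>The rearrangement of y lies in the unit ball of E exactly because y lies in that
    of the symmetrization.\<close>
  also have "\<dots> \<le> kothe_ennorm I E N (rearr_real I x)"
    by (rule kothe_ennorm_upper[where M = N, OF y(3,4)])
  finally show "(\<integral>\<^sup>+t. ennreal \<bar>x t * y t\<bar> \<partial>lebesgue_on I) \<le> kothe_ennorm I E N (rearr_real I x)" .
qed

lemma symm_kothe_subset:
  assumes "x \<in> symm_kothe_set"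
  shows "x \<in> kothe_symm_set" "kothe_symm_norm x \<le> symm_kothe_norm x"
proof -
  have x: "x \<in> L0 I" "AE t in lebesgue_on I. rearr I x t < \<infinity>" "kothe_ennorm I E N (rearr_real I x) < \<infinity>"
    using assms by (auto simp: symm_set_def kothe_set_def)
  note le = kothe_symm_ennorm_le[OF x(1,2)]
  show "x \<in> kothe_symm_set"
    using x(1) le_less_trans[OF le x(3)] by (simp add: kothe_set_def)
  show "kothe_symm_norm x \<le> symm_kothe_norm x"
    unfolding symm_norm_def[of I "kothe_norm I E N" x] kothe_norm_def using le x(3) by (intro enn2real_mono) auto
qed

lemma resonance_kothe_symm:
  assumes x: "x \<in> L0 I" and z: "z \<in> E" "N z \<le> 1" "\<And>t. t \<in> I \<Longrightarrow> 0 \<le> z t" "antimono_on I z"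
  shows "(\<integral>\<^sup>+t. erearr x t * ennreal (z t) \<partial>lebesgue_on I) \<le> kothe_symm_ennorm x"
proof (rule resonance[OF x z(3,4)])
  fix w assume "w \<in> L0 I" "\<And>t. t \<in> I \<Longrightarrow> rearr I w t \<le> ereal (z t)"
  from symm_set_I[OF this(1) z(1) this(2)]
  show "(\<integral>\<^sup>+t. ennreal \<bar>x t * w t\<bar> \<partial>lebesgue_on I) \<le> kothe_symm_ennorm x"
    using z(2) by (intro kothe_ennorm_upper) auto
qed

section \<open>Finiteness of rearrangements and definiteness of the dual norm\<close>

lemma distr_fun_zero_imp:
  assumes "x \<in> L0 I" "distr_fun x 0 = 0"
  shows "AE t in lebesgue_on I. x t = 0"
  using assms sets_level[OF assms(1), of 0]
  by (intro AE_I[of _ _ "{s\<in>I. 0 < \<bar>x s\<bar>}"]) (auto simp: distr_fun_def)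

text \<open>A nonzero x in the symmetrization exceeds some level r > 0 on a set of positive measure.
  Its rearrangement then exceeds r on an initial interval, and the ideal property puts the step of
  height r into E; scaling brings it into the unit ball.\<close>

lemma initial_step_in_E:
  obtains a c where "a \<in> I" "0 < c" "(\<lambda>t. if t < a then c else 0) \<in> E" "N (\<lambda>t. if t < a then c else 0) \<le> 1"
proof -
  obtain x where x: "x \<in> symm_set I E" "\<not> (AE t in lebesgue_on I. x t = 0)"
    using symm_nonzero by (auto simp: nonzero_space_def)
  then have xL: "x \<in> L0 I" and xE: "rearr_real I x \<in> E" and fin: "AE t in lebesgue_on I. rearr I x t < \<infinity>"
    by (auto simp: symm_set_def)
  have "0 < distr_fun x 0"
    using distr_fun_zero_imp[OF xL] x(2) by (auto simp: zero_less_iff_neq_zero)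
  also have "distr_fun x 0 = (SUP n. distr_fun x (0 + 1 / real (Suc n)))"
    by (rule distr_fun_right_cont[OF xL])
  finally obtain n where n: "0 < distr_fun x (1 / real (Suc n))" by (auto simp: less_SUP_iff)
  define r where "r = 1 / real (Suc n)"
  have r: "0 < r" "0 < distr_fun x r" using n by (auto simp: r_def)
  then obtain b where b: "0 < b" "b < distr_fun x r" using dense by blast
  then obtain a where a: "b = ennreal a" "0 \<le> a" by (cases b) auto
  then have a_pos: "0 < a" using b by (auto simp: ennreal_less_zero_iff)
  have aI: "a \<in> I" using a_pos b(2) distr_fun_le[of x r] a(1) by (auto simp: mem_I_iff)
  define z where "z = (\<lambda>t. if t < a then r else 0)"
  have "(\<lambda>s. s) \<in> borel_measurable (lebesgue_on I)"
    by (intro measurable_restrict_space1 measurable_completion) auto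
  then have zL: "z \<in> L0 I"
    unfolding z_def L0_def by measurable
  have "AE t in lebesgue_on I. \<bar>z t\<bar> \<le> \<bar>rearr_real I x t\<bar>"
    using fin
  proof eventually_elim
    case (elim t)
    show ?case
    proof (cases "t < a")
      case True
      then have "ennreal t < distr_fun x r"
        using le_less_trans[OF ennreal_leI, of t a] b a by simp
      then have "ereal r < rearr I x t" using less_rearr_iff[OF xL, of r t] r by simp
      then have "r < rearr_real I x t"
        using elim by (cases "rearr I x t") (auto simp: rearr_real_def)
      then show ?thesis using r by (simp add: z_def True)
    qed (simp add: z_def)
  qed
  then have zE: "z \<in> E"
    using ideal_space xE zL unfolding quasi_normed_ideal_space_def by blast
  \<comment> \<open>The summand 1 makes the denominator positive from N z \<ge> 0 alone.\<close>
  define d where "d = 1 / (N z + 1)"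
  have d: "0 < d" "d * N z \<le> 1"
    using N_nonneg[OF zE] by (auto simp: d_def divide_simps)
  have eq: "(\<lambda>t. d * z t) = (\<lambda>t. if t < a then d * r else 0)"
    by (auto simp: z_def)
  show thesis
    using that[of a "d * r"] aI d r E_scale[OF zE, of d] by (simp add: eq)
qed

text \<open>The step function from \<open>initial_step_in_E\<close> serves as z in
  \<open>resonance_kothe_symm\<close>. On (0,s) the rearrangement is at least its value at s, so
  that value times c s is below the integral.\<close>

lemma erearr_bound:
  obtains a c where "a \<in> I" "0 < c"
    "\<And>x s. x \<in> L0 I \<Longrightarrow> s \<in> I \<Longrightarrow> s \<le> a \<Longrightarrow> erearr x s * ennreal (c * s) \<le> kothe_symm_ennorm x"
proof -
  obtain a c where ac: "a \<in> I" "0 < c" "(\<lambda>t. if t < a then c else 0) \<in> E" "N (\<lambda>t. if t < a then c else 0) \<le> 1"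
    by (rule initial_step_in_E)
  have "erearr x s * ennreal (c * s) \<le> kothe_symm_ennorm x"
    if x: "x \<in> L0 I" and s: "s \<in> I" "s \<le> a" for x s
  proof -
    have sub: "{0<..<s} \<subseteq> I" and s0: "0 < s" using I_down[OF s(1)] s by (auto simp: mem_I_iff)
    have "erearr x s * ennreal (c * s) = (erearr x s * ennreal c) * emeasure (lebesgue_on I) {0<..<s}"
      using s0 ac by (simp add: emeasure_on_I[OF sub] ennreal_mult mult.assoc)
    also have "\<dots> = (\<integral>\<^sup>+t. (erearr x s * ennreal c) * indicator {0<..<s} t \<partial>lebesgue_on I)"
      using sub by (subst nn_integral_cmult_indicator) (auto simp: sets_restrict_space_iff)
    also have "\<dots> \<le> (\<integral>\<^sup>+t. erearr x t * ennreal (if t < a then c else 0) \<partial>lebesgue_on I)"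
      using s by (intro nn_integral_mono)
        (auto intro!: mult_right_mono erearr_antimono split: split_indicator)
    also have "\<dots> \<le> kothe_symm_ennorm x"
      using ac by (intro resonance_kothe_symm x) (auto intro!: monotone_onI)
    finally show ?thesis .
  qed
  then show thesis using that ac by blast
qed

lemma rearr_finite:
  assumes x: "x \<in> kothe_symm_set" and t: "t \<in> I"
  shows "rearr I x t < \<infinity>"
proof -
  obtain a c where ac: "a \<in> I" "0 < c"
    "\<And>x s. x \<in> L0 I \<Longrightarrow> s \<in> I \<Longrightarrow> s \<le> a \<Longrightarrow> erearr x s * ennreal (c * s) \<le> kothe_symm_ennorm x"
    by (rule erearr_bound) blast
  \<comment> \<open>The pointwise bound reaches only up to a. For larger t, monotonicity of the
    rearrangement carries finiteness over from a.\<close>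
  define s where "s = min t a"
  have s: "s \<in> I" "s \<le> a" "s \<le> t" "0 < s" using t ac(1) by (auto simp: s_def min_def mem_I_iff)
  have "erearr x s * ennreal (c * s) < \<infinity>"
    using ac(3)[OF _ s(1,2), of x] x by (auto simp: kothe_set_def intro: le_less_trans)
  then have "erearr x s < \<infinity>"
    using s ac(2) by (auto simp: ennreal_mult_less_top ennreal_eq_0_iff mult_le_0_iff)
  then have "erearr x t < \<infinity>" using erearr_antimono[OF s(3), of x] by (rule le_less_trans[rotated])
  then show ?thesis by (simp only: erearr_finite_iff)
qed

text \<open>If the dual norm vanishes, \<open>erearr_bound\<close> makes the rearrangement vanish at
  every s in (0,a]. The support of x then has measure at most s for arbitrarily small s.\<close>

lemma kothe_symm_ennorm_zero_iff:
  assumes x: "x \<in> L0 I"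
  shows "kothe_symm_ennorm x = 0 \<longleftrightarrow> (AE t in lebesgue_on I. x t = 0)"
proof
  assume K0: "kothe_symm_ennorm x = 0"
  obtain a c where ac: "a \<in> I" "0 < c"
    "\<And>x s. x \<in> L0 I \<Longrightarrow> s \<in> I \<Longrightarrow> s \<le> a \<Longrightarrow> erearr x s * ennreal (c * s) \<le> kothe_symm_ennorm x"
    by (rule erearr_bound) blast
  have le: "distr_fun x 0 \<le> ennreal s" if s: "0 < s" "s \<le> a" for s
  proof -
    have "s \<in> I" using I_down[OF ac(1)] s by auto
    then have "erearr x s * ennreal (c * s) = 0" using ac(3)[OF x _ s(2)] K0 by simp
    then have "erearr x s = 0" using s ac(2) by (simp add: ennreal_eq_0_iff mult_le_0_iff)
    then show ?thesis using less_erearr_iff[OF x, of 0 s] by simp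
  qed
  have "distr_fun x 0 = 0"
  proof (rule ccontr)
    assume "distr_fun x 0 \<noteq> 0"
    then have "0 < min (distr_fun x 0) (ennreal a)"
      using ac(1) by (auto simp: zero_less_iff_neq_zero min_def mem_I_iff)
    then obtain b where b: "0 < b" "b < min (distr_fun x 0) (ennreal a)" using dense by blast
    then obtain s where s: "b = ennreal s" "0 \<le> s" by (cases b) auto
    have "ennreal s < ennreal a" "0 < ennreal s" using b s by auto
    then have "0 < s" "s \<le> a" using s(2) by (auto simp: ennreal_less_iff)
    then show False using le[of s] b s by (auto dest: leD)
  qed
  then show "AE t in lebesgue_on I. x t = 0" by (rule distr_fun_zero_imp[OF x])
next
  assume "AE t in lebesgue_on I. x t = 0"
  then have "(\<integral>\<^sup>+t. ennreal \<bar>x t * y t\<bar> \<partial>lebesgue_on I) = 0" for y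
    by (subst nn_integral_cong_AE[where v = "\<lambda>_. 0"]) auto
  then have "kothe_symm_ennorm x \<le> 0"
    unfolding kothe_ennorm_def by (intro SUP_least) simp
  then show "kothe_symm_ennorm x = 0" by simp
qed

lemma kothe_symm_norm_zero_iff:
  assumes "x \<in> kothe_symm_set"
  shows "kothe_symm_norm x = 0 \<longleftrightarrow> (AE t in lebesgue_on I. x t = 0)"
  using assms kothe_symm_ennorm_zero_iff[of x]
  by (auto simp: kothe_set_def kothe_norm_def enn2real_eq_0_iff)

lemma quasi_norm_kothe_symm: "quasi_norm_on I kothe_symm_set kothe_symm_norm"
proof -
  note add = kothe_ennorm_add[OF symm_set_L0[of E], where M = "symm_norm I N"]
  note scale = kothe_ennorm_scale[OF symm_set_L0[of E] _ symm_set_ne, where M = "symm_norm I N"]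
  have fin: "kothe_symm_ennorm x < top" if "x \<in> kothe_symm_set" for x
    using that by (simp add: kothe_set_def)
  have L: "x \<in> L0 I" if "x \<in> kothe_symm_set" for x
    using that by (simp add: kothe_set_def)
  have cong: "kothe_symm_ennorm x = kothe_symm_ennorm y" if "AE t in lebesgue_on I. x t = y t" for x y
    using that by (intro kothe_ennorm_cong_AE) auto
  have "linear_subspace_L0 I kothe_symm_set"
    unfolding linear_subspace_L0_def
  proof (intro conjI ballI allI impI)
    show "kothe_symm_set \<subseteq> L0 I" using L by blast
  next
    fix x y assume "x \<in> kothe_symm_set" "y \<in> L0 I" "AE t in lebesgue_on I. x t = y t"
    then show "y \<in> kothe_symm_set" using cong[of x y] by (simp add: kothe_set_def)
  next
    show "(\<lambda>t. 0) \<in> kothe_symm_set"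
      using kothe_symm_ennorm_zero_iff[of "\<lambda>t. 0"] by (simp add: kothe_set_def L0_def)
  next
    fix x y assume xy: "x \<in> kothe_symm_set" "y \<in> kothe_symm_set"
    have "kothe_symm_ennorm (\<lambda>t. x t + y t) < top"
      by (rule le_less_trans[OF add[OF L L, OF xy]]) (use fin xy in auto)
    then show "(\<lambda>t. x t + y t) \<in> kothe_symm_set"
      using L[OF xy(1)] L[OF xy(2)] by (simp add: kothe_set_def L0_def)
  next
    fix c x assume "x \<in> kothe_symm_set"
    then show "(\<lambda>t. c * x t) \<in> kothe_symm_set"
      using scale[of x c] by (auto simp: kothe_set_def L0_def ennreal_mult_less_top)
  qed
  then show ?thesis
  \<comment> \<open>A supremum of integrals of |x y| over fixed y is subadditive in x, so the
    constant is 1.\<close>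
  proof (rule quasi_norm_onI[where C = 1])
    show "kothe_symm_norm x = 0 \<longleftrightarrow> (AE t in lebesgue_on I. x t = 0)" if "x \<in> kothe_symm_set" for x
      by (rule kothe_symm_norm_zero_iff[OF that])
  next
    show "kothe_symm_norm (\<lambda>t. c * x t) = \<bar>c\<bar> * kothe_symm_norm x" if "x \<in> kothe_symm_set" for c x
      using scale[OF L[OF that], of c] by (simp add: kothe_norm_def enn2real_mult)
  next
    show "kothe_symm_norm (\<lambda>t. x t + y t) \<le> 1 * (kothe_symm_norm x + kothe_symm_norm y)"
      if "x \<in> kothe_symm_set" "y \<in> kothe_symm_set" for x y
    proof -
      have "kothe_symm_norm (\<lambda>t. x t + y t) \<le> enn2real (kothe_symm_ennorm x + kothe_symm_ennorm y)"
        unfolding kothe_norm_def using add[OF L L, OF that] fin[OF that(1)] fin[OF that(2)]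
        by (intro enn2real_mono) auto
      also have "\<dots> = kothe_symm_norm x + kothe_symm_norm y"
        using fin[OF that(1)] fin[OF that(2)] by (simp add: kothe_norm_def enn2real_plus)
      finally show ?thesis by simp
    qed
  next
    show "kothe_symm_norm x = kothe_symm_norm y" if "AE t in lebesgue_on I. x t = y t" for x y
      using cong[OF that] by (simp add: kothe_norm_def)
  next
    show "0 \<le> kothe_symm_norm x" for x by (simp add: kothe_norm_def)
  qed simp
qed

section \<open>The embedding that uses boundedness of H*\<close>

lemma Hstar_bound_mono: "Hstar_bound I E N C \<Longrightarrow> C \<le> C' \<Longrightarrow> Hstar_bound I E N C'"
  unfolding Hstar_bound_def using N_nonneg by (meson mult_right_mono order_trans)

text \<open>The ideal property allows y to be replaced by |y|, for which H*|y| is nonnegative and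
  decreasing. This dominates y against a rearrangement and is, up to the factor C, a function to
  which resonance applies.\<close>

lemma erearr_integral_le:
  assumes C: "Hstar_bound I E N C" "0 < C" and x: "x \<in> L0 I" and y: "y \<in> E" "N y \<le> 1"
  shows "(\<integral>\<^sup>+t. erearr x t * ennreal \<bar>y t\<bar> \<partial>lebesgue_on I) \<le> ennreal C * kothe_symm_ennorm x"
proof -
  have yL: "(\<lambda>t. \<bar>y t\<bar>) \<in> L0 I" using E_L0[OF y(1)] by (simp add: L0_def)
  have yE: "(\<lambda>t. \<bar>y t\<bar>) \<in> E" "N (\<lambda>t. \<bar>y t\<bar>) \<le> 1"
    using E_ideal[OF y(1) yL] y(2) by auto
  let ?H = "Hstar I (\<lambda>t. \<bar>y t\<bar>)"
  have int: "\<And>t. t \<in> I \<Longrightarrow> set_integrable lebesgue ({t<..} \<inter> I) (\<lambda>s. \<bar>y s\<bar> / s)"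
    and HE: "?H \<in> E" and HN: "N ?H \<le> C * N (\<lambda>t. \<bar>y t\<bar>)"
    using C(1) yE(1) unfolding Hstar_bound_def by auto
  have H0: "0 \<le> ?H t" if "t \<in> I" for t by (rule ennreal_Hstar(2)[OF that _ int[OF that]]) simp
  have Hanti: "antimono_on I ?H" by (rule Hstar_antimono[OF _ int]) simp
  \<comment> \<open>Division by the positive bound C brings H*|y| into the unit ball of E; the
    factor C returns outside the integral.\<close>
  define z where "z t = (1 / C) * ?H t" for t
  have zE: "z \<in> E" unfolding z_def[abs_def] by (rule E_scale(1)[OF HE])
  have "N z = \<bar>1 / C\<bar> * N ?H" unfolding z_def[abs_def] by (rule E_scale(2)[OF HE])
  moreover have "N ?H \<le> C" using HN mult_left_mono[OF yE(2), of C] C(2) by linarith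
  ultimately have zN: "N z \<le> 1" using C(2) by (simp add: pos_divide_le_eq)
  have z0: "0 \<le> z t" if "t \<in> I" for t using H0[OF that] C(2) by (simp add: z_def)
  have zanti: "antimono_on I z"
    using Hanti C(2) by (auto simp: monotone_on_def z_def divide_right_mono)
  have [measurable]: "z \<in> borel_measurable (lebesgue_on I)"
    using E_L0[OF zE] by (simp add: L0_def)
  have "(\<integral>\<^sup>+t. erearr x t * ennreal \<bar>y t\<bar> \<partial>lebesgue_on I) \<le> (\<integral>\<^sup>+t. erearr x t * ennreal (?H t) \<partial>lebesgue_on I)"
    by (rule erearr_le_Hstar[OF yL _ int]) simp
  also have "\<dots> = (\<integral>\<^sup>+t. ennreal C * (erearr x t * ennreal (z t)) \<partial>lebesgue_on I)"
  proof (rule nn_integral_cong)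
    fix t assume "t \<in> space (lebesgue_on I)"
    then have "ennreal (?H t) = ennreal C * ennreal (z t)"
      using C(2) z0[of t] by (simp add: z_def flip: ennreal_mult)
    then show "erearr x t * ennreal (?H t) = ennreal C * (erearr x t * ennreal (z t))"
      by (simp add: ac_simps)
  qed
  also have "\<dots> = ennreal C * (\<integral>\<^sup>+t. erearr x t * ennreal (z t) \<partial>lebesgue_on I)"
    by (rule nn_integral_cmult) measurable
  also have "\<dots> \<le> ennreal C * kothe_symm_ennorm x"
    by (intro mult_left_mono resonance_kothe_symm x zE zN z0 zanti) auto
  finally show ?thesis .
qed

lemma kothe_symm_subset_pos:
  assumes C: "Hstar_bound I E N C" "0 < C" and x: "x \<in> kothe_symm_set"
  shows "x \<in> symm_kothe_set" "symm_kothe_norm x \<le> C * kothe_symm_norm x"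
proof -
  have xL: "x \<in> L0 I" and fin: "kothe_symm_ennorm x < top" using x by (auto simp: kothe_set_def)
  have rf: "AE t in lebesgue_on I. rearr I x t < \<infinity>"
    using rearr_finite[OF x] by (intro AE_I2) simp
  have le: "kothe_ennorm I E N (rearr_real I x) \<le> ennreal C * kothe_symm_ennorm x"
  proof (subst kothe_ennorm_def, rule SUP_least)
    fix y assume "y \<in> {y \<in> E. N y \<le> 1}"
    then show "(\<integral>\<^sup>+t. ennreal \<bar>rearr_real I x t * y t\<bar> \<partial>lebesgue_on I) \<le> ennreal C * kothe_symm_ennorm x"
      using erearr_integral_le[OF C xL] by (simp add: nn_integral_rearr_real[OF rf])
  qed
  have fin': "ennreal C * kothe_symm_ennorm x < top" using fin by (simp add: ennreal_mult_less_top)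
  show "x \<in> symm_kothe_set"
    using xL rf le_less_trans[OF le fin'] rearr_real_L0 by (simp add: symm_set_def kothe_set_def)
  have "enn2real (kothe_ennorm I E N (rearr_real I x)) \<le> enn2real (ennreal C * kothe_symm_ennorm x)"
    using le fin' by (intro enn2real_mono) auto
  then show "symm_kothe_norm x \<le> C * kothe_symm_norm x"
    using C(2) by (simp add: symm_norm_def[of I "kothe_norm I E N"] kothe_norm_def enn2real_mult)
qed

text \<open>The inequality is proved for each bound D separately, and the infimum is taken in the
  inequality itself, so it is never necessary to show that the infimum is again a bound for
  H*.\<close>

lemma kothe_symm_subset:
  assumes H: "Hstar_bounded I E N" and x: "x \<in> kothe_symm_set"
  shows "x \<in> symm_kothe_set" "symm_kothe_norm x \<le> Hstar_opnorm I E N * kothe_symm_norm x"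
proof -
  obtain C where C: "Hstar_bound I E N C" using H by (auto simp: Hstar_bounded_def)
  then have C0: "0 \<le> C" by (simp add: Hstar_bound_def)
  have C1: "Hstar_bound I E N (C + 1)" "0 < C + 1"
    using Hstar_bound_mono[OF C] C0 by auto
  show "x \<in> symm_kothe_set" by (rule kothe_symm_subset_pos(1)[OF C1 x])
  let ?k = "kothe_symm_norm x" and ?n = "symm_kothe_norm x"
  have k0: "0 \<le> ?k" by (simp add: kothe_norm_def)
  have bound: "?n \<le> D * ?k" if D: "Hstar_bound I E N D" for D
  proof (cases "?k = 0")
    case True
    then show ?thesis using kothe_symm_subset_pos(2)[OF C1 x] by simp
  next
    case False
    then have k: "0 < ?k" using k0 by simp
    show ?thesis
    proof (rule field_le_epsilon)
      fix e :: real assume e: "0 < e"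
      \<comment> \<open>The increment makes the constant positive even if D = 0, and after
        multiplication by \<open>?k\<close> it costs exactly e.\<close>
      have "Hstar_bound I E N (D + e / ?k)" "0 < D + e / ?k"
        using Hstar_bound_mono[OF D, of "D + e / ?k"] D k e by (auto simp: Hstar_bound_def add_nonneg_pos)
      from kothe_symm_subset_pos(2)[OF this x] show "?n \<le> D * ?k + e"
        using k by (simp add: distrib_right)
    qed
  qed
  show "?n \<le> Hstar_opnorm I E N * ?k"
  proof (cases "?k = 0")
    case True
    then show ?thesis using bound[OF C] by simp
  next
    case False
    then have k: "0 < ?k" using k0 by simp
    have "?n / ?k \<le> Hstar_opnorm I E N"
      unfolding Hstar_opnorm_def using C bound k
      by (intro cInf_greatest) (auto simp: pos_divide_le_eq)
    then show ?thesis using k by (simp add: pos_divide_le_eq)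
  qed
qed

lemma quasi_norm_symm_kothe:
  assumes H: "Hstar_bounded I E N" and eq: "symm_kothe_set = kothe_symm_set"
  shows "quasi_norm_on I symm_kothe_set symm_kothe_norm"
proof -
  obtain C where "Hstar_bound I E N C" using H by (auto simp: Hstar_bounded_def)
  \<comment> \<open>The maximum is positive, as \<open>kothe_symm_subset_pos\<close> demands, and at
    least 1, as the constant in a quasi-triangle inequality must be.\<close>
  then have C: "Hstar_bound I E N (max 1 C)" by (rule Hstar_bound_mono) simp
  have lin: "linear_subspace_L0 I kothe_symm_set"
    using quasi_norm_kothe_symm unfolding quasi_norm_on_def by (rule conjunct1)
  have low: "kothe_symm_norm x \<le> symm_kothe_norm x" if "x \<in> kothe_symm_set" for x
    using symm_kothe_subset(2)[of x] that by (simp add: eq)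
  have up: "symm_kothe_norm x \<le> max 1 C * kothe_symm_norm x" if "x \<in> kothe_symm_set" for x
    by (rule kothe_symm_subset_pos(2)[OF C _ that]) simp
  have L: "x \<in> L0 I" if "x \<in> kothe_symm_set" for x
    using that by (simp add: kothe_set_def)
  have E0: "E \<noteq> {}" using ideal_space unfolding quasi_normed_ideal_space_def by blast
  have nonneg: "0 \<le> symm_kothe_norm x" for x
    by (simp add: symm_norm_def[of I "kothe_norm I E N"] kothe_norm_def)
  have cong: "symm_kothe_norm x = symm_kothe_norm y"
    if "x \<in> L0 I" "y \<in> L0 I" "AE t in lebesgue_on I. x t = y t" for x y
  proof -
    have "rearr I x = rearr I y" using that by (intro rearr_cong_AE) auto
    then show ?thesis by (simp add: symm_norm_def[of I "kothe_norm I E N"] rearr_real_def[abs_def])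
  qed
  have zero: "symm_kothe_norm x = 0 \<longleftrightarrow> (AE t in lebesgue_on I. x t = 0)" if x: "x \<in> kothe_symm_set" for x
  proof -
    have "symm_kothe_norm x = 0 \<longleftrightarrow> kothe_symm_norm x = 0"
      using low[OF x] up[OF x] nonneg[of x] by (auto simp: kothe_norm_def intro: antisym)
    then show ?thesis using kothe_symm_norm_zero_iff[OF x] by simp
  qed
  have scale: "symm_kothe_norm (\<lambda>t. c * x t) = \<bar>c\<bar> * symm_kothe_norm x" if x: "x \<in> kothe_symm_set" for c x
  proof (cases "c = 0")
    \<comment> \<open>\<open>rearr_scale\<close> covers only c \<noteq> 0; here definiteness gives
      the value 0.\<close>
    case True
    have "(\<lambda>t. 0) \<in> kothe_symm_set" using lin unfolding linear_subspace_L0_def by blast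
    then show ?thesis using zero[of "\<lambda>t. 0"] True by simp
  next
    case False
    have "rearr_real I (\<lambda>t. c * x t) = (\<lambda>t. \<bar>c\<bar> * rearr_real I x t)"
      using rearr_scale[OF L[OF x] False] by (simp add: rearr_real_def fun_eq_iff)
    then show ?thesis
      using kothe_ennorm_scale[OF _ rearr_real_L0 E0, of N "\<bar>c\<bar>" x] E_L0
      by (simp add: symm_norm_def[of I "kothe_norm I E N"] kothe_norm_def subset_iff enn2real_mult)
  qed
  have tri: "symm_kothe_norm (\<lambda>t. x t + y t) \<le> max 1 C * (symm_kothe_norm x + symm_kothe_norm y)"
    if x: "x \<in> kothe_symm_set" and y: "y \<in> kothe_symm_set" for x y
  proof -
    have xy: "(\<lambda>t. x t + y t) \<in> kothe_symm_set"
      using lin x y unfolding linear_subspace_L0_def by blast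
    have "kothe_symm_ennorm (\<lambda>t. x t + y t) \<le> kothe_symm_ennorm x + kothe_symm_ennorm y"
      by (rule kothe_ennorm_add[OF symm_set_L0 L[OF x] L[OF y]])
    then have "kothe_symm_norm (\<lambda>t. x t + y t) \<le> enn2real (kothe_symm_ennorm x + kothe_symm_ennorm y)"
      unfolding kothe_norm_def using x y by (intro enn2real_mono) (auto simp: kothe_set_def)
    also have "\<dots> = kothe_symm_norm x + kothe_symm_norm y"
      unfolding kothe_norm_def using x y by (intro enn2real_plus) (auto simp: kothe_set_def)
    also have "\<dots> \<le> symm_kothe_norm x + symm_kothe_norm y"
      by (intro add_mono low x y)
    finally have "max 1 C * kothe_symm_norm (\<lambda>t. x t + y t) \<le> max 1 C * (symm_kothe_norm x + symm_kothe_norm y)"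
      by (rule mult_left_mono) simp
    then show ?thesis using up[OF xy] by simp
  qed
  show ?thesis
    unfolding eq
  proof (rule quasi_norm_onI[where C = "max 1 C"])
    show "linear_subspace_L0 I kothe_symm_set" by (rule lin)
    show "1 \<le> max 1 C" by (rule max.cobounded1)
  qed (use cong L zero scale nonneg tri in simp_all)
qed

end

theorem theorem2:
  fixes I :: "real set"
    and E :: "(real \<Rightarrow> real) set"
    and N :: "(real \<Rightarrow> real) \<Rightarrow> real"
  assumes "I = {0<..<1} \<or> I = {0<..}"
    and "quasi_Banach_ideal_space I E N"
    and "nonzero_space I (symm_set I E)"
    and "dilation2_bounded_on_cone I E N"
    and "nonzero_space I (symm_set I (kothe_set I E N))"
  shows
    "symm_set I (kothe_set I E N) \<subseteq> kothe_set I (symm_set I E) (symm_norm I N) \<and>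
     (\<forall>x \<in> symm_set I (kothe_set I E N).
        kothe_norm I (symm_set I E) (symm_norm I N) x \<le> symm_norm I (kothe_norm I E N) x) \<and>
     (Hstar_bounded I E N \<longrightarrow>
        kothe_set I (symm_set I E) (symm_norm I N) \<subseteq> symm_set I (kothe_set I E N) \<and>
        (\<forall>x \<in> kothe_set I (symm_set I E) (symm_norm I N).
           symm_norm I (kothe_norm I E N) x
             \<le> Hstar_opnorm I E N * kothe_norm I (symm_set I E) (symm_norm I N) x) \<and>
        quasi_norm_on I (symm_set I (kothe_set I E N)) (symm_norm I (kothe_norm I E N)) \<and>
        quasi_norm_on I (kothe_set I (symm_set I E) (symm_norm I N))
          (kothe_norm I (symm_set I E) (symm_norm I N)) \<and>
        symm_set I (kothe_set I E N) = kothe_set I (symm_set I E) (symm_norm I N) \<and>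
        equivalent_on (symm_set I (kothe_set I E N))
          (symm_norm I (kothe_norm I E N)) (kothe_norm I (symm_set I E) (symm_norm I N)))"
proof -
  interpret ideal_on_interval I E N
    using assms by unfold_locales (auto simp: quasi_Banach_ideal_space_def)
  have sub: "symm_kothe_set \<subseteq> kothe_symm_set"
    using symm_kothe_subset(1) by blast
  have le: "\<forall>x\<in>symm_kothe_set. kothe_symm_norm x \<le> symm_kothe_norm x"
    using symm_kothe_subset(2) by blast
  have eq: "symm_kothe_set = kothe_symm_set" if "Hstar_bounded I E N"
    using sub kothe_symm_subset(1)[OF that] by blast
  have equiv: "equivalent_on symm_kothe_set symm_kothe_norm kothe_symm_norm" if H: "Hstar_bounded I E N"
  proof -
    obtain C where C: "Hstar_bound I E N C" using H by (auto simp: Hstar_bounded_def)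
    \<comment> \<open>\<open>equivalent_on\<close> asks for strictly positive constants, while C may
      be 0; hence the factor 1/(C+1).\<close>
    then have D: "Hstar_bound I E N (C + 1)" "0 < C + 1"
      using Hstar_bound_mono[OF C, of "C + 1"] by (auto simp: Hstar_bound_def)
    have "1 / (C + 1) * symm_kothe_norm x \<le> kothe_symm_norm x" if "x \<in> symm_kothe_set" for x
      using kothe_symm_subset_pos(2)[OF D, of x] that sub D(2)
      by (simp add: pos_divide_le_eq mult.commute subset_iff)
    then show ?thesis
      unfolding equivalent_on_def using le D(2)
      by (intro exI[of _ "1 / (C + 1)"] exI[of _ 1] conjI) auto
  qed
  show ?thesis
    by (intro conjI impI sub le ballI subsetI kothe_symm_subset quasi_norm_symm_kothe
        quasi_norm_kothe_symm eq equiv)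
qed

end
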